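(* (i) Let $A\subset B$ be rings, and let $I$ be an ideal in $B$ which is ultimately power stable in $A$. If $I\cap A$ is a finitely generated projective $A$-module of rank one, then $I$ is power stable in $A$. (ii) Let $A\subset B$ be Noetherian rings, and let $I$ be an ideal in $B$ which is ultimately power stable in $A$. If $I\cap A=J$ is a radical ideal of $A$ which is generated by a regular $A$-sequence, then $I$ is power stable in $A$.
   Context: All rings are commutative with identity. For rings $A\subset B$, an ideal $I$ of $B$ is called power stable in $A$ if $I^n\cap A=(I\cap A)^n$ for all $n\geq 1$, and ultimately power stable in $A$ if $I^n\cap A=(I\cap A)^n$ for all sufficiently large $n$. *)

theory Defs
  imports "HOL-Algebra.Module" "HOL-Algebra.Ideal_Product" "HOL-Algebra.Subrings"
    "HOL-Algebra.Ring_Divisibility"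
begin

section \<open>Power stable ideals\<close>

text \<open>
  A subring \<open>A\<close> of \<open>B\<close> is given by its carrier set (\<^term>\<open>subring A B\<close>); as a ring of its own it is
  \<^term>\<open>B\<lparr>carrier := A\<rparr>\<close>.  Powers of ideals are taken in the library's multiplicative monoid of
  ideals, so that \<open>ideal_pow R I 0 = carrier R\<close> and \<open>ideal_pow R I (Suc n) = ideal_pow R I n \<cdot>\<^bsub>R\<^esub> I\<close>.
\<close>

definition ideal_pow :: "('a, 'r) ring_scheme \<Rightarrow> 'a set \<Rightarrow> nat \<Rightarrow> 'a set" where
  "ideal_pow R I n = I [^]\<^bsub>ideals_set R\<^esub> n"

lemma ideal_pow_0 [simp]: "ideal_pow R I 0 = carrier R"
  and ideal_pow_Suc [simp]: "ideal_pow R I (Suc n) = ideal_pow R I n \<cdot>\<^bsub>R\<^esub> I"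
  by (simp_all add: ideal_pow_def nat_pow_def ideals_set_def)

definition power_stable :: "'a set \<Rightarrow> ('a, 'r) ring_scheme \<Rightarrow> 'a set \<Rightarrow> bool" where
  "power_stable A B I \<longleftrightarrow>
     (\<forall>n\<ge>1. ideal_pow B I n \<inter> A = ideal_pow (B\<lparr>carrier := A\<rparr>) (I \<inter> A) n)"

definition ultimately_power_stable :: "'a set \<Rightarrow> ('a, 'r) ring_scheme \<Rightarrow> 'a set \<Rightarrow> bool" where
  "ultimately_power_stable A B I \<longleftrightarrow>
     (\<exists>N. \<forall>n\<ge>N. ideal_pow B I n \<inter> A = ideal_pow (B\<lparr>carrier := A\<rparr>) (I \<inter> A) n)"


section \<open>Finitely generated, free and projective modules\<close>

text \<open>The fields \<open>mult\<close> and \<open>one\<close>, which every module record carries, play no role.\<close>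

definition ideal_module :: "('a, 'r) ring_scheme \<Rightarrow> 'a set \<Rightarrow> ('a, 'a) module" where
  "ideal_module R J = \<lparr>carrier = J, monoid.mult = monoid.mult R, one = one R, zero = zero R, add = add R,
                       smult = monoid.mult R\<rparr>"

definition fg_module :: "('a, 'r) ring_scheme \<Rightarrow> ('a, 'm, 'x) module_scheme \<Rightarrow> bool" where
  "fg_module R M \<longleftrightarrow>
     (\<exists>S. finite S \<and> S \<subseteq> carrier M \<and> carrier M = \<Inter>{H. submodule H R M \<and> S \<subseteq> H})"

definition free_of_rank ::
    "('a, 'r) ring_scheme \<Rightarrow> ('a, 'm, 'x) module_scheme \<Rightarrow> nat \<Rightarrow> bool" where
  "free_of_rank R M n \<longleftrightarrow>
     (\<exists>e \<in> {..<n} \<rightarrow> carrier M. \<forall>x \<in> carrier M.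
        \<exists>!r. r \<in> {..<n} \<rightarrow>\<^sub>E carrier R \<and> x = (\<Oplus>\<^bsub>M\<^esub> i \<in> {..<n}. r i \<odot>\<^bsub>M\<^esub> e i))"

definition linear_maps ::
    "('a, 'r) ring_scheme \<Rightarrow> ('a, 'm, 'x) module_scheme \<Rightarrow> ('a, 'n, 'y) module_scheme
       \<Rightarrow> ('m \<Rightarrow> 'n) set" where
  "linear_maps R M N = {f \<in> carrier M \<rightarrow> carrier N.
     (\<forall>x\<in>carrier M. \<forall>y\<in>carrier M. f (x \<oplus>\<^bsub>M\<^esub> y) = f x \<oplus>\<^bsub>N\<^esub> f y) \<and>
     (\<forall>r\<in>carrier R. \<forall>x\<in>carrier M. f (r \<odot>\<^bsub>M\<^esub> x) = r \<odot>\<^bsub>N\<^esub> f x)}"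

text \<open>
  Projectivity is the lifting property against surjections \<open>g : N \<rightarrow> N'\<close>.  A definition cannot
  quantify over types, so \<open>N\<close> and \<open>N'\<close> range over modules on fixed types, which are large enough to
  contain the free module on the set \<^term>\<open>carrier M\<close> and \<open>M\<close> itself.  Lemma \<open>projective_module_lift\<close>
  below shows that the lifting property then holds for modules on arbitrary types.
\<close>

definition projective_module :: "('a, 'r) ring_scheme \<Rightarrow> ('a, 'm, 'x) module_scheme \<Rightarrow> bool" where
  "projective_module R M \<longleftrightarrow> module R M \<and>
     (\<forall>(N :: ('a, 'm \<Rightarrow> 'a) module) (N' :: ('a, 'm) module) g h.
        module R N \<and> module R N' \<and> g \<in> linear_maps R N N' \<and> g ` carrier N = carrier N' \<and>
        h \<in> linear_maps R M N' \<longrightarrow>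
        (\<exists>k \<in> linear_maps R M N. \<forall>x\<in>carrier M. g (k x) = h x))"


subsection \<open>Lifting for modules on arbitrary types\<close>

text \<open>The free module on \<open>X\<close>: finitely supported functions from \<open>X\<close> to \<open>R\<close>.\<close>

definition free_on :: "('a, 'r) ring_scheme \<Rightarrow> 'm set \<Rightarrow> ('a, 'm \<Rightarrow> 'a) module" where
  "free_on R X = \<lparr>carrier = {f \<in> X \<rightarrow>\<^sub>E carrier R. finite {x\<in>X. f x \<noteq> \<zero>\<^bsub>R\<^esub>}},
     monoid.mult = undefined, one = undefined, zero = (\<lambda>x\<in>X. \<zero>\<^bsub>R\<^esub>),
     add = (\<lambda>f g. \<lambda>x\<in>X. f x \<oplus>\<^bsub>R\<^esub> g x), smult = (\<lambda>r f. \<lambda>x\<in>X. r \<otimes>\<^bsub>R\<^esub> f x)\<rparr>"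

lemma free_on_module:
  fixes R (structure)
  assumes "cring R" shows "module R (free_on R X)"
proof -
  interpret cring R by fact
  show ?thesis
  proof (rule moduleI)
    show "abelian_group (free_on R X)"
    proof (rule abelian_groupI)
      fix f g assume fg: "f \<in> carrier (free_on R X)" "g \<in> carrier (free_on R X)"
      have "{x\<in>X. f x \<oplus> g x \<noteq> \<zero>} \<subseteq> {x\<in>X. f x \<noteq> \<zero>} \<union> {x\<in>X. g x \<noteq> \<zero>}"
        by auto
      moreover have "finite \<dots>" using fg by (simp add: free_on_def)
      ultimately have "finite {x\<in>X. f x \<oplus> g x \<noteq> \<zero>}" by (rule finite_subset)
      then show "f \<oplus>\<^bsub>free_on R X\<^esub> g \<in> carrier (free_on R X)"
        using fg by (auto simp: free_on_def PiE_iff cong: conj_cong)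
    next
      fix f assume f: "f \<in> carrier (free_on R X)"
      have "{x\<in>X. \<ominus> f x \<noteq> \<zero>} \<subseteq> {x\<in>X. f x \<noteq> \<zero>}"
        by auto
      moreover have "finite \<dots>" using f by (simp add: free_on_def)
      ultimately have "finite {x\<in>X. \<ominus> f x \<noteq> \<zero>}" by (rule finite_subset)
      then have "(\<lambda>x\<in>X. \<ominus> f x) \<in> carrier (free_on R X)"
        using f by (auto simp: free_on_def PiE_iff cong: conj_cong)
      moreover have "(\<lambda>x\<in>X. \<ominus> f x) \<oplus>\<^bsub>free_on R X\<^esub> f = \<zero>\<^bsub>free_on R X\<^esub>"
        using f by (auto simp: free_on_def PiE_iff restrict_def l_neg)
      ultimately show "\<exists>g\<in>carrier (free_on R X). g \<oplus>\<^bsub>free_on R X\<^esub> f = \<zero>\<^bsub>free_on R X\<^esub>"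
        by blast
    qed (auto simp: free_on_def PiE_iff restrict_def extensional_def a_ac
        intro!: ext cong: conj_cong)
    fix r f assume r: "r \<in> carrier R" and f: "f \<in> carrier (free_on R X)"
    have "{x\<in>X. r \<otimes> f x \<noteq> \<zero>} \<subseteq> {x\<in>X. f x \<noteq> \<zero>}"
      using r by auto
    moreover have "finite \<dots>" using f by (simp add: free_on_def)
    ultimately have "finite {x\<in>X. r \<otimes> f x \<noteq> \<zero>}" by (rule finite_subset)
    then show "r \<odot>\<^bsub>free_on R X\<^esub> f \<in> carrier (free_on R X)"
      using r f by (auto simp: free_on_def PiE_iff cong: conj_cong)
  qed (auto simp: free_on_def PiE_iff restrict_def extensional_def l_distr r_distr m_assoc assms
        intro!: ext)
qed

definition free_ext ::
    "('a, 'r) ring_scheme \<Rightarrow> 'm set \<Rightarrow> ('a, 'n, 'y) module_scheme \<Rightarrow> ('m \<Rightarrow> 'n) \<Rightarrow> ('m \<Rightarrow> 'a) \<Rightarrow> 'n" where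
  "free_ext R X N t f = (\<Oplus>\<^bsub>N\<^esub> x \<in> {x\<in>X. f x \<noteq> \<zero>\<^bsub>R\<^esub>}. f x \<odot>\<^bsub>N\<^esub> t x)"

lemma free_ext_superset:
  assumes "module R N" "t \<in> X \<rightarrow> carrier N" "f \<in> carrier (free_on R X)"
    and "finite Y" "Y \<subseteq> X" "{x\<in>X. f x \<noteq> \<zero>\<^bsub>R\<^esub>} \<subseteq> Y"
  shows "free_ext R X N t f = (\<Oplus>\<^bsub>N\<^esub> x \<in> Y. f x \<odot>\<^bsub>N\<^esub> t x)"
proof -
  interpret module R N by fact
  show ?thesis
    unfolding free_ext_def
    by (rule M.add.finprod_mono_neutral_cong_left)
       (use assms in \<open>auto simp: free_on_def PiE_iff Pi_iff subset_iff\<close>)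
qed

lemma free_ext_linear:
  fixes R (structure)
  assumes N: "module R N" and t: "t \<in> X \<rightarrow> carrier N"
  shows "free_ext R X N t \<in> linear_maps R (free_on R X) N"
proof -
  interpret module R N by fact
  let ?F = "free_on R X"
  interpret F: module R ?F by (rule free_on_module) (rule R.is_cring)
  have carr: "f x \<in> carrier R" if "f \<in> carrier ?F" "x \<in> X" for f x
    using that by (auto simp: free_on_def)
  have fin: "finite {x\<in>X. f x \<noteq> \<zero>}" if "f \<in> carrier ?F" for f
    using that by (auto simp: free_on_def)
  show ?thesis
    unfolding linear_maps_def
  proof (safe)
    fix f assume f: "f \<in> carrier ?F"
    show "free_ext R X N t f \<in> carrier N"
      unfolding free_ext_def by (rule M.finsum_closed) (use carr[OF f] t in auto)
  next
    fix f g assume f: "f \<in> carrier ?F" and g: "g \<in> carrier ?F"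
    define Y where "Y = {x\<in>X. f x \<noteq> \<zero>} \<union> {x\<in>X. g x \<noteq> \<zero>}"
    have Y: "finite Y" "Y \<subseteq> X" using fin[OF f] fin[OF g] by (auto simp: Y_def)
    have fg: "f \<oplus>\<^bsub>?F\<^esub> g \<in> carrier ?F" using f g by simp
    have ev: "(f \<oplus>\<^bsub>?F\<^esub> g) x = f x \<oplus> g x" if "x \<in> X" for x
      using that by (simp add: free_on_def)
    have "free_ext R X N t (f \<oplus>\<^bsub>?F\<^esub> g) = (\<Oplus>\<^bsub>N\<^esub> x \<in> Y. (f \<oplus>\<^bsub>?F\<^esub> g) x \<odot>\<^bsub>N\<^esub> t x)"
      by (rule free_ext_superset[OF N t fg Y]) (auto simp: Y_def ev)
    also have "\<dots> = (\<Oplus>\<^bsub>N\<^esub> x \<in> Y. f x \<odot>\<^bsub>N\<^esub> t x \<oplus>\<^bsub>N\<^esub> g x \<odot>\<^bsub>N\<^esub> t x)"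
      by (rule M.finsum_cong') (use Y carr[OF f] carr[OF g] t in \<open>auto simp: ev smult_l_distr Pi_iff subset_iff\<close>)
    also have "\<dots> = (\<Oplus>\<^bsub>N\<^esub> x \<in> Y. f x \<odot>\<^bsub>N\<^esub> t x) \<oplus>\<^bsub>N\<^esub> (\<Oplus>\<^bsub>N\<^esub> x \<in> Y. g x \<odot>\<^bsub>N\<^esub> t x)"
      by (rule M.finsum_addf) (use Y carr[OF f] carr[OF g] t in \<open>auto simp: Pi_iff subset_iff\<close>)
    also have "\<dots> = free_ext R X N t f \<oplus>\<^bsub>N\<^esub> free_ext R X N t g"
      by (intro arg_cong2[where f = "add N"] free_ext_superset[symmetric] N t f g Y)
         (auto simp: Y_def)
    finally show "free_ext R X N t (f \<oplus>\<^bsub>?F\<^esub> g) = free_ext R X N t f \<oplus>\<^bsub>N\<^esub> free_ext R X N t g" .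
  next
    fix r f assume r: "r \<in> carrier R" and f: "f \<in> carrier ?F"
    define Y where "Y = {x\<in>X. f x \<noteq> \<zero>}"
    have Y: "finite Y" "Y \<subseteq> X" using fin[OF f] by (auto simp: Y_def)
    have rf: "r \<odot>\<^bsub>?F\<^esub> f \<in> carrier ?F" using r f by simp
    have ev: "(r \<odot>\<^bsub>?F\<^esub> f) x = r \<otimes> f x" if "x \<in> X" for x
      using that by (simp add: free_on_def)
    have "free_ext R X N t (r \<odot>\<^bsub>?F\<^esub> f) = (\<Oplus>\<^bsub>N\<^esub> x \<in> Y. (r \<odot>\<^bsub>?F\<^esub> f) x \<odot>\<^bsub>N\<^esub> t x)"
      by (rule free_ext_superset[OF N t rf Y]) (use r in \<open>auto simp: Y_def ev\<close>)
    also have "\<dots> = (\<Oplus>\<^bsub>N\<^esub> x \<in> Y. r \<odot>\<^bsub>N\<^esub> (f x \<odot>\<^bsub>N\<^esub> t x))"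
      by (rule M.finsum_cong') (use Y r carr[OF f] t in \<open>auto simp: ev smult_assoc1 Pi_iff subset_iff\<close>)
    also have "\<dots> = r \<odot>\<^bsub>N\<^esub> (\<Oplus>\<^bsub>N\<^esub> x \<in> Y. f x \<odot>\<^bsub>N\<^esub> t x)"
      by (rule finsum_smult_ldistr[symmetric]) (use Y r carr[OF f] t in \<open>auto simp: Pi_iff subset_iff\<close>)
    finally show "free_ext R X N t (r \<odot>\<^bsub>?F\<^esub> f) = r \<odot>\<^bsub>N\<^esub> free_ext R X N t f"
      by (simp add: free_ext_def Y_def)
  qed
qed

lemma linear_maps_finsum:
  assumes "module R M" "module R N" "g \<in> linear_maps R M N" "finite Y" "u \<in> Y \<rightarrow> carrier M"
  shows "g (\<Oplus>\<^bsub>M\<^esub> x \<in> Y. u x) = (\<Oplus>\<^bsub>N\<^esub> x \<in> Y. g (u x))"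
proof -
  interpret M: module R M by fact
  interpret N: module R N by fact
  have cl: "g x \<in> carrier N" if "x \<in> carrier M" for x
    using assms(3) that by (auto simp: linear_maps_def)
  have z: "g \<zero>\<^bsub>M\<^esub> = \<zero>\<^bsub>N\<^esub>"
  proof -
    have "g (\<zero>\<^bsub>R\<^esub> \<odot>\<^bsub>M\<^esub> \<zero>\<^bsub>M\<^esub>) = \<zero>\<^bsub>R\<^esub> \<odot>\<^bsub>N\<^esub> g \<zero>\<^bsub>M\<^esub>"
      using assms(3) M.R.zero_closed M.M.zero_closed unfolding linear_maps_def by blast
    then show ?thesis using cl by simp
  qed
  show ?thesis using assms(4,5)
  proof (induction Y rule: finite_induct)
    case empty then show ?case by (simp add: z)
  next
    case (insert x Y)
    have "g (u x \<oplus>\<^bsub>M\<^esub> finsum M u Y) = g (u x) \<oplus>\<^bsub>N\<^esub> g (finsum M u Y)"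
      using assms(3) insert.prems by (auto simp: linear_maps_def Pi_iff)
    then show ?case using insert cl by (simp add: Pi_iff)
  qed
qed

lemma projective_module_lift:
  fixes R :: "('a, 'r) ring_scheme" and M :: "('a, 'm, 'x) module_scheme"
    and N :: "('a, 'n, 'y) module_scheme" and N' :: "('a, 'k, 'z) module_scheme"
  assumes P: "projective_module R M" and N: "module R N" and N': "module R N'"
    and g: "g \<in> linear_maps R N N'" "g ` carrier N = carrier N'"
    and h: "h \<in> linear_maps R M N'"
  shows "\<exists>k \<in> linear_maps R M N. \<forall>x\<in>carrier M. g (k x) = h x"
proof -
  have M: "module R M" using P by (simp add: projective_module_def)
  interpret M: module R M by fact
  interpret N: module R N by fact
  interpret N': module R N' by fact
  let ?X = "carrier M"
  let ?F = "free_on R ?X"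
  have F: "module R ?F" by (rule free_on_module) (rule M.R.is_cring)
  define M0 where "M0 = module.truncate M"
  have M0s [simp]: "carrier M0 = carrier M" "add M0 = add M" "zero M0 = zero M" "smult M0 = smult M"
    by (simp_all add: M0_def module.defs)
  have M0: "module R M0"
    by (rule moduleI)
       (auto intro!: abelian_groupI M.R.is_cring M.M.a_assoc M.M.a_comm M.smult_l_distr M.smult_r_distr
          M.smult_assoc1 intro: M.M.l_neg M.M.add.inv_closed)
  define p where "p = free_ext R ?X M0 (\<lambda>x. x)"
  have p: "p \<in> linear_maps R ?F M0"
    unfolding p_def by (rule free_ext_linear[OF M0]) auto
  have supp_fin: "finite {x\<in>?X. f x \<noteq> \<zero>\<^bsub>R\<^esub>}" and supp_cl: "f \<in> ?X \<rightarrow> carrier R" 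
    if "f \<in> carrier ?F" for f
    using that by (auto simp: free_on_def)
  have "m \<in> p ` carrier ?F" if m: "m \<in> carrier M" for m
  proof -
    define d where "d = (\<lambda>x\<in>?X. if x = m then \<one>\<^bsub>R\<^esub> else \<zero>\<^bsub>R\<^esub>)"
    have sub: "{x\<in>?X. d x \<noteq> \<zero>\<^bsub>R\<^esub>} \<subseteq> {m}" by (auto simp: d_def)
    then have "finite {x\<in>?X. d x \<noteq> \<zero>\<^bsub>R\<^esub>}" by (rule finite_subset) simp
    then have d: "d \<in> carrier ?F" unfolding free_on_def by (auto simp: d_def)
    interpret M0: module R M0 by (rule M0)
    have "p d = (\<Oplus>\<^bsub>M0\<^esub> x \<in> {m}. d x \<odot>\<^bsub>M0\<^esub> x)"
      unfolding p_def by (rule free_ext_superset[OF M0 _ d]) (use sub m in auto)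
    also have "\<dots> = m" using m M0.M.finsum_insert[of "{}" m "\<lambda>x. d x \<odot>\<^bsub>M0\<^esub> x"] by (simp add: d_def)
    finally show ?thesis using d by (metis image_eqI)
  qed
  moreover have "p ` carrier ?F \<subseteq> carrier M0" using p by (auto simp: linear_maps_def)
  ultimately have psurj: "p ` carrier ?F = carrier M0" by auto
  have "(\<lambda>x. x) \<in> linear_maps R M M0" by (auto simp: linear_maps_def)
  then obtain s where s: "s \<in> linear_maps R M ?F" and ps: "\<And>x. x \<in> carrier M \<Longrightarrow> p (s x) = x"
    using P F M0 p psurj unfolding projective_module_def by blast
  have scl: "s x \<in> carrier ?F" if "x \<in> carrier M" for x
    using s that by (auto simp: linear_maps_def)
  have "\<forall>x\<in>carrier M. \<exists>y\<in>carrier N. g y = h x"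
  proof
    fix x assume "x \<in> carrier M"
    then have "h x \<in> g ` carrier N" using g(2) h by (auto simp: linear_maps_def)
    then show "\<exists>y\<in>carrier N. g y = h x" by auto
  qed
  then obtain t where t: "\<And>x. x \<in> carrier M \<Longrightarrow> t x \<in> carrier N \<and> g (t x) = h x"
    by metis
  define k where "k = (\<lambda>m. free_ext R ?X N t (s m))"
  have e: "free_ext R ?X N t \<in> linear_maps R ?F N"
    by (rule free_ext_linear[OF N]) (use t in auto)
  have "k \<in> linear_maps R M N"
    using e s scl unfolding linear_maps_def k_def by auto
  moreover have "g (k m) = h m" if m: "m \<in> carrier M" for m
  proof -
    define Y where "Y = {x\<in>?X. s m x \<noteq> \<zero>\<^bsub>R\<^esub>}"
    have Y: "finite Y" "Y \<subseteq> ?X" using supp_fin[OF scl[OF m]] by (auto simp: Y_def)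
    have c: "s m x \<in> carrier R" if "x \<in> Y" for x using supp_cl[OF scl[OF m]] Y that by auto
    have hcl: "h x \<in> carrier N'" if "x \<in> carrier M" for x using h that by (auto simp: linear_maps_def)
    have "g (k m) = (\<Oplus>\<^bsub>N'\<^esub> x \<in> Y. g (s m x \<odot>\<^bsub>N\<^esub> t x))"
      unfolding k_def free_ext_def Y_def[symmetric]
      by (rule linear_maps_finsum[OF N N' g(1) Y(1)]) (use c t Y in auto)
    also have "\<dots> = (\<Oplus>\<^bsub>N'\<^esub> x \<in> Y. h (s m x \<odot>\<^bsub>M0\<^esub> x))"
    proof (rule N'.M.finsum_cong')
      fix x assume x: "x \<in> Y"
      then have "x \<in> carrier M" using Y by auto
      then show "g (s m x \<odot>\<^bsub>N\<^esub> t x) = h (s m x \<odot>\<^bsub>M0\<^esub> x)"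
        using g(1) h c[OF x] t by (auto simp: linear_maps_def)
    qed (use c Y hcl in auto)
    also have "\<dots> = h (p (s m))"
    proof -
      have h0: "h \<in> linear_maps R M0 N'" using h by (simp add: linear_maps_def)
      show ?thesis unfolding p_def free_ext_def Y_def[symmetric]
        by (rule linear_maps_finsum[OF M0 N' h0 Y(1), symmetric]) (use c Y in auto)
    qed
    finally show ?thesis using ps m by simp
  qed
  ultimately show ?thesis by blast
qed


section \<open>Localization and rank\<close>

text \<open>
  \<open>frac R S M m s\<close> is the fraction \<open>m/s\<close> in \<open>S\<inverse>M\<close>, an equivalence class of pairs.  The operations
  on classes are the unions over all choices of representatives, which are unions of equal classes.
\<close>

definition frac_rel ::
    "('a, 'r) ring_scheme \<Rightarrow> 'a set \<Rightarrow> ('a, 'm, 'x) module_scheme \<Rightarrow> (('m \<times> 'a) \<times> ('m \<times> 'a)) set"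
  where
  "frac_rel R S M = {((m, s), (m', s')). m \<in> carrier M \<and> s \<in> S \<and> m' \<in> carrier M \<and> s' \<in> S \<and>
     (\<exists>u\<in>S. u \<odot>\<^bsub>M\<^esub> (s' \<odot>\<^bsub>M\<^esub> m) = u \<odot>\<^bsub>M\<^esub> (s \<odot>\<^bsub>M\<^esub> m'))}"

definition frac ::
    "('a, 'r) ring_scheme \<Rightarrow> 'a set \<Rightarrow> ('a, 'm, 'x) module_scheme \<Rightarrow> 'm \<Rightarrow> 'a \<Rightarrow> ('m \<times> 'a) set"
  where
  "frac R S M m s = frac_rel R S M `` {(m, s)}"

definition loc_module ::
    "('a, 'r) ring_scheme \<Rightarrow> 'a set \<Rightarrow> ('a, 'm, 'x) module_scheme
       \<Rightarrow> (('a \<times> 'a) set, ('m \<times> 'a) set) module" where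
  "loc_module R S M =
    \<lparr>carrier = (carrier M \<times> S) // frac_rel R S M,
     monoid.mult = undefined,
     one = undefined,
     zero = frac R S M \<zero>\<^bsub>M\<^esub> \<one>\<^bsub>R\<^esub>,
     add = (\<lambda>X Y. \<Union>(m, s)\<in>X. \<Union>(m', s')\<in>Y.
              frac R S M (s' \<odot>\<^bsub>M\<^esub> m \<oplus>\<^bsub>M\<^esub> s \<odot>\<^bsub>M\<^esub> m') (s \<otimes>\<^bsub>R\<^esub> s')),
     smult = (\<lambda>X Y. \<Union>(a, s)\<in>X. \<Union>(m, t)\<in>Y. frac R S M (a \<odot>\<^bsub>M\<^esub> m) (s \<otimes>\<^bsub>R\<^esub> t))\<rparr>"

text \<open>The operations are well defined on fractions.\<close>

context
  fixes R :: "('a, 'r) ring_scheme" and S :: "'a set" and M :: "('a, 'm, 'x) module_scheme"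
  assumes M: "module R M" and S: "submonoid S R"
begin

interpretation module R M by (rule M)

lemma loc_S_carr: "s \<in> S \<Longrightarrow> s \<in> carrier R"
  using S submonoid.subset by blast

lemma loc_S_mult: "s \<in> S \<Longrightarrow> t \<in> S \<Longrightarrow> s \<otimes>\<^bsub>R\<^esub> t \<in> S"
  using S submonoid.m_closed by metis

lemma loc_S_one: "\<one>\<^bsub>R\<^esub> \<in> S"
  using S submonoid.one_closed by metis

lemma frac_rel_equiv: "equiv (carrier M \<times> S) (frac_rel R S M)"
proof (rule equivI)
  show "frac_rel R S M \<subseteq> (carrier M \<times> S) \<times> (carrier M \<times> S)" by (auto simp: frac_rel_def)
  show "refl_on (carrier M \<times> S) (frac_rel R S M)"
    using loc_S_one by (auto simp: refl_on_def frac_rel_def)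
  show "sym (frac_rel R S M)" by (auto simp: sym_def frac_rel_def) metis
  show "trans (frac_rel R S M)"
  proof (rule transI, clarsimp simp: frac_rel_def)
    fix m1 s1 m2 s2 m3 s3 u v
    assume c: "m1 \<in> carrier M" "m2 \<in> carrier M" "m3 \<in> carrier M"
      and s: "s1 \<in> S" "s2 \<in> S" "s3 \<in> S" "u \<in> S" "v \<in> S"
      and e1: "u \<odot>\<^bsub>M\<^esub> (s2 \<odot>\<^bsub>M\<^esub> m1) = u \<odot>\<^bsub>M\<^esub> (s1 \<odot>\<^bsub>M\<^esub> m2)"
      and e2: "v \<odot>\<^bsub>M\<^esub> (s3 \<odot>\<^bsub>M\<^esub> m2) = v \<odot>\<^bsub>M\<^esub> (s2 \<odot>\<^bsub>M\<^esub> m3)"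
    note sc = s[THEN loc_S_carr]
    have "(u \<otimes>\<^bsub>R\<^esub> v \<otimes>\<^bsub>R\<^esub> s2) \<odot>\<^bsub>M\<^esub> (s3 \<odot>\<^bsub>M\<^esub> m1) = (v \<otimes>\<^bsub>R\<^esub> s3) \<odot>\<^bsub>M\<^esub> (u \<odot>\<^bsub>M\<^esub> (s2 \<odot>\<^bsub>M\<^esub> m1))"
      using c sc by (simp add: smult_assoc1[symmetric] R.m_ac)
    also have "\<dots> = (u \<otimes>\<^bsub>R\<^esub> s1) \<odot>\<^bsub>M\<^esub> (v \<odot>\<^bsub>M\<^esub> (s3 \<odot>\<^bsub>M\<^esub> m2))"
      using c sc by (simp add: e1) (simp add: smult_assoc1[symmetric] R.m_ac)
    also have "\<dots> = (u \<otimes>\<^bsub>R\<^esub> v \<otimes>\<^bsub>R\<^esub> s2) \<odot>\<^bsub>M\<^esub> (s1 \<odot>\<^bsub>M\<^esub> m3)"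
      using c sc by (simp add: e2) (simp add: smult_assoc1[symmetric] R.m_ac)
    finally show "\<exists>w\<in>S. w \<odot>\<^bsub>M\<^esub> (s3 \<odot>\<^bsub>M\<^esub> m1) = w \<odot>\<^bsub>M\<^esub> (s1 \<odot>\<^bsub>M\<^esub> m3)"
      using s loc_S_mult by blast
  qed
qed

lemma frac_eq_iff:
  assumes "m \<in> carrier M" "m' \<in> carrier M" "s \<in> S" "s' \<in> S"
  shows "frac R S M m s = frac R S M m' s' \<longleftrightarrow>
    (\<exists>u\<in>S. u \<odot>\<^bsub>M\<^esub> (s' \<odot>\<^bsub>M\<^esub> m) = u \<odot>\<^bsub>M\<^esub> (s \<odot>\<^bsub>M\<^esub> m'))"
  unfolding frac_def using eq_equiv_class_iff[OF frac_rel_equiv, of "(m,s)" "(m',s')"] assms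
  by (auto simp: frac_rel_def)

lemma mem_frac:
  assumes "m \<in> carrier M" "s \<in> S"
  shows "(m', s') \<in> frac R S M m s \<longleftrightarrow> m' \<in> carrier M \<and> s' \<in> S \<and> frac R S M m' s' = frac R S M m s"
proof -
  have "(m', s') \<in> frac R S M m s \<longleftrightarrow> m' \<in> carrier M \<and> s' \<in> S \<and>
    (\<exists>u\<in>S. u \<odot>\<^bsub>M\<^esub> (s' \<odot>\<^bsub>M\<^esub> m) = u \<odot>\<^bsub>M\<^esub> (s \<odot>\<^bsub>M\<^esub> m'))"
    using assms by (auto simp: frac_def frac_rel_def)
  then show ?thesis using frac_eq_iff[OF assms(1) _ assms(2)] by metis
qed

lemma loc_add_frac:
  assumes a: "m \<in> carrier M" "s \<in> S" and b: "n \<in> carrier M" "t \<in> S"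
  shows "frac R S M m s \<oplus>\<^bsub>loc_module R S M\<^esub> frac R S M n t =
    frac R S M (t \<odot>\<^bsub>M\<^esub> m \<oplus>\<^bsub>M\<^esub> s \<odot>\<^bsub>M\<^esub> n) (s \<otimes>\<^bsub>R\<^esub> t)"
proof -
  have *: "frac R S M (t' \<odot>\<^bsub>M\<^esub> m' \<oplus>\<^bsub>M\<^esub> s' \<odot>\<^bsub>M\<^esub> n') (s' \<otimes>\<^bsub>R\<^esub> t') =
        frac R S M (t \<odot>\<^bsub>M\<^esub> m \<oplus>\<^bsub>M\<^esub> s \<odot>\<^bsub>M\<^esub> n) (s \<otimes>\<^bsub>R\<^esub> t)"
    if mn: "(m', s') \<in> frac R S M m s" "(n', t') \<in> frac R S M n t" for m' s' n' t'
  proof -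
    have c: "m' \<in> carrier M" "n' \<in> carrier M" and s': "s' \<in> S" "t' \<in> S"
      using mn a b by (auto simp: mem_frac)
    obtain u where u: "u \<in> S" "u \<odot>\<^bsub>M\<^esub> (s \<odot>\<^bsub>M\<^esub> m') = u \<odot>\<^bsub>M\<^esub> (s' \<odot>\<^bsub>M\<^esub> m)"
      using mn(1) a c s' by (metis mem_frac frac_eq_iff)
    obtain v where v: "v \<in> S" "v \<odot>\<^bsub>M\<^esub> (t \<odot>\<^bsub>M\<^esub> n') = v \<odot>\<^bsub>M\<^esub> (t' \<odot>\<^bsub>M\<^esub> n)"
      using mn(2) b c s' by (metis mem_frac frac_eq_iff)
    note sc = a(2)[THEN loc_S_carr] b(2)[THEN loc_S_carr] s'[THEN loc_S_carr] u(1)[THEN loc_S_carr] v(1)[THEN loc_S_carr]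
    have "(u \<otimes>\<^bsub>R\<^esub> v) \<odot>\<^bsub>M\<^esub> ((s \<otimes>\<^bsub>R\<^esub> t) \<odot>\<^bsub>M\<^esub> (t' \<odot>\<^bsub>M\<^esub> m' \<oplus>\<^bsub>M\<^esub> s' \<odot>\<^bsub>M\<^esub> n'))
      = (v \<otimes>\<^bsub>R\<^esub> t \<otimes>\<^bsub>R\<^esub> t') \<odot>\<^bsub>M\<^esub> (u \<odot>\<^bsub>M\<^esub> (s \<odot>\<^bsub>M\<^esub> m')) \<oplus>\<^bsub>M\<^esub> (u \<otimes>\<^bsub>R\<^esub> s \<otimes>\<^bsub>R\<^esub> s') \<odot>\<^bsub>M\<^esub> (v \<odot>\<^bsub>M\<^esub> (t \<odot>\<^bsub>M\<^esub> n'))"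
      using a b c sc by (simp add: smult_assoc1[symmetric] smult_r_distr R.m_ac)
    also have "\<dots> = (u \<otimes>\<^bsub>R\<^esub> v) \<odot>\<^bsub>M\<^esub> ((s' \<otimes>\<^bsub>R\<^esub> t') \<odot>\<^bsub>M\<^esub> (t \<odot>\<^bsub>M\<^esub> m \<oplus>\<^bsub>M\<^esub> s \<odot>\<^bsub>M\<^esub> n))"
      unfolding u v using a b c sc by (simp add: smult_assoc1[symmetric] smult_r_distr R.m_ac)
    finally have "\<exists>w\<in>S. w \<odot>\<^bsub>M\<^esub> ((s \<otimes>\<^bsub>R\<^esub> t) \<odot>\<^bsub>M\<^esub> (t' \<odot>\<^bsub>M\<^esub> m' \<oplus>\<^bsub>M\<^esub> s' \<odot>\<^bsub>M\<^esub> n'))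
        = w \<odot>\<^bsub>M\<^esub> ((s' \<otimes>\<^bsub>R\<^esub> t') \<odot>\<^bsub>M\<^esub> (t \<odot>\<^bsub>M\<^esub> m \<oplus>\<^bsub>M\<^esub> s \<odot>\<^bsub>M\<^esub> n))"
      using loc_S_mult[OF u(1) v(1)] by blast
    moreover have "t' \<odot>\<^bsub>M\<^esub> m' \<oplus>\<^bsub>M\<^esub> s' \<odot>\<^bsub>M\<^esub> n' \<in> carrier M" "t \<odot>\<^bsub>M\<^esub> m \<oplus>\<^bsub>M\<^esub> s \<odot>\<^bsub>M\<^esub> n \<in> carrier M"
      using a b c sc by simp_all
    ultimately show ?thesis
      using frac_eq_iff[OF _ _ loc_S_mult[OF s'] loc_S_mult[OF a(2) b(2)]] by blast
  qed
  have "(m, s) \<in> frac R S M m s" "(n, t) \<in> frac R S M n t" using a b by (auto simp: mem_frac)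
  note mem = this
  show ?thesis
    unfolding loc_module_def module.simps ring.simps partial_object.simps
    by (rule UN_constant_eq[OF mem(1)], clarify, rule UN_constant_eq[OF mem(2)], clarify) (rule *)
qed

lemma loc_smult_frac:
  assumes a: "a \<in> carrier R" "s \<in> S" and b: "n \<in> carrier M" "t \<in> S"
  shows "frac R S (ideal_module R (carrier R)) a s \<odot>\<^bsub>loc_module R S M\<^esub> frac R S M n t =
    frac R S M (a \<odot>\<^bsub>M\<^esub> n) (s \<otimes>\<^bsub>R\<^esub> t)"
proof -
  let ?A = "ideal_module R (carrier R)"
  have *: "frac R S M (a' \<odot>\<^bsub>M\<^esub> n') (s' \<otimes>\<^bsub>R\<^esub> t') = frac R S M (a \<odot>\<^bsub>M\<^esub> n) (s \<otimes>\<^bsub>R\<^esub> t)"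
    if mn: "(a', s') \<in> frac R S ?A a s" "(n', t') \<in> frac R S M n t" for a' s' n' t'
  proof -
    have c: "a' \<in> carrier R" "n' \<in> carrier M" and s': "s' \<in> S" "t' \<in> S"
      using mn a b by (auto simp: mem_frac frac_def frac_rel_def ideal_module_def)
    obtain u where u: "u \<in> S" "u \<otimes>\<^bsub>R\<^esub> (s' \<otimes>\<^bsub>R\<^esub> a) = u \<otimes>\<^bsub>R\<^esub> (s \<otimes>\<^bsub>R\<^esub> a')"
      using mn by (auto simp: frac_def frac_rel_def ideal_module_def)
    obtain v where v: "v \<in> S" "v \<odot>\<^bsub>M\<^esub> (t \<odot>\<^bsub>M\<^esub> n') = v \<odot>\<^bsub>M\<^esub> (t' \<odot>\<^bsub>M\<^esub> n)"
      using mn(2) b c s' by (metis mem_frac frac_eq_iff)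
    note sc = a(2)[THEN loc_S_carr] b(2)[THEN loc_S_carr] s'[THEN loc_S_carr] u(1)[THEN loc_S_carr] v(1)[THEN loc_S_carr]
    have "(u \<otimes>\<^bsub>R\<^esub> v) \<odot>\<^bsub>M\<^esub> ((s \<otimes>\<^bsub>R\<^esub> t) \<odot>\<^bsub>M\<^esub> (a' \<odot>\<^bsub>M\<^esub> n'))
      = (u \<otimes>\<^bsub>R\<^esub> (s \<otimes>\<^bsub>R\<^esub> a')) \<odot>\<^bsub>M\<^esub> (v \<odot>\<^bsub>M\<^esub> (t \<odot>\<^bsub>M\<^esub> n'))"
      using a b c sc by (simp add: smult_assoc1[symmetric] R.m_ac)
    also have "\<dots> = (u \<otimes>\<^bsub>R\<^esub> v) \<odot>\<^bsub>M\<^esub> ((s' \<otimes>\<^bsub>R\<^esub> t') \<odot>\<^bsub>M\<^esub> (a \<odot>\<^bsub>M\<^esub> n))"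
      unfolding u(2)[symmetric] v(2) using a b c sc by (simp add: smult_assoc1[symmetric] R.m_ac)
    finally have "\<exists>w\<in>S. w \<odot>\<^bsub>M\<^esub> ((s \<otimes>\<^bsub>R\<^esub> t) \<odot>\<^bsub>M\<^esub> (a' \<odot>\<^bsub>M\<^esub> n'))
        = w \<odot>\<^bsub>M\<^esub> ((s' \<otimes>\<^bsub>R\<^esub> t') \<odot>\<^bsub>M\<^esub> (a \<odot>\<^bsub>M\<^esub> n))"
      using loc_S_mult[OF u(1) v(1)] by blast
    moreover have "a' \<odot>\<^bsub>M\<^esub> n' \<in> carrier M" "a \<odot>\<^bsub>M\<^esub> n \<in> carrier M"
      using a b c sc by simp_all
    ultimately show ?thesis
      using frac_eq_iff[OF _ _ loc_S_mult[OF s'] loc_S_mult[OF a(2) b(2)]] by blast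
  qed
  have "(a, s) \<in> frac R S ?A a s" "(n, t) \<in> frac R S M n t"
    using a b loc_S_one by (auto simp: mem_frac) (auto simp: frac_def frac_rel_def ideal_module_def)
  note mem = this
  show ?thesis
    unfolding loc_module_def module.simps ring.simps partial_object.simps
    by (rule UN_constant_eq[OF mem(1)], clarify, rule UN_constant_eq[OF mem(2)], clarify) (rule *)
qed

end

text \<open>The ring \<open>S\<inverse>R\<close> is the localization of \<open>R\<close> as a module over itself, with its multiplication.\<close>

definition loc_ring :: "('a, 'r) ring_scheme \<Rightarrow> 'a set \<Rightarrow> ('a \<times> 'a) set ring" where
  "loc_ring R S = (let M = ideal_module R (carrier R); L = loc_module R S M in
    \<lparr>carrier = carrier L, monoid.mult = smult L, one = frac R S M \<one>\<^bsub>R\<^esub> \<one>\<^bsub>R\<^esub>,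
     zero = zero L, add = add L\<rparr>)"

definition has_rank ::
    "('a, 'r) ring_scheme \<Rightarrow> ('a, 'm, 'x) module_scheme \<Rightarrow> nat \<Rightarrow> bool" where
  "has_rank R M n \<longleftrightarrow>
     (\<forall>P. primeideal P R \<longrightarrow>
        free_of_rank (loc_ring R (carrier R - P)) (loc_module R (carrier R - P) M) n)"


section \<open>Radical ideals and regular sequences\<close>

definition radical :: "('a, 'r) ring_scheme \<Rightarrow> 'a set \<Rightarrow> 'a set" where
  "radical R J = {x \<in> carrier R. \<exists>n::nat. n \<ge> 1 \<and> x [^]\<^bsub>R\<^esub> n \<in> J}"

definition radical_ideal :: "('a, 'r) ring_scheme \<Rightarrow> 'a set \<Rightarrow> bool" where
  "radical_ideal R J \<longleftrightarrow> ideal J R \<and> radical R J = J"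

definition nonzerodivisor :: "('a, 'r) ring_scheme \<Rightarrow> 'a \<Rightarrow> bool" where
  "nonzerodivisor R a \<longleftrightarrow>
     a \<in> carrier R \<and> (\<forall>x\<in>carrier R. a \<otimes>\<^bsub>R\<^esub> x = \<zero>\<^bsub>R\<^esub> \<longrightarrow> x = \<zero>\<^bsub>R\<^esub>)"

text \<open>
  The usual convention that a regular sequence generates a proper ideal is part of the definition;
  the empty sequence (in a nonzero ring) is regular.
\<close>

definition regular_sequence :: "('a, 'r) ring_scheme \<Rightarrow> 'a list \<Rightarrow> bool" where
  "regular_sequence R xs \<longleftrightarrow> set xs \<subseteq> carrier R \<and>
     (\<forall>i<length xs. let K = Idl\<^bsub>R\<^esub> (set (take i xs)) in
        nonzerodivisor (R Quot K) (K +>\<^bsub>R\<^esub> (xs ! i))) \<and>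
     Idl\<^bsub>R\<^esub> (set xs) \<noteq> carrier R"

end

theory Submission
  imports Defs
begin

text \<open>
  Put \<open>J = I \<inter> A\<close>; always \<open>J\<^sup>n \<subseteq> I\<^sup>n \<inter> A\<close>.  Let \<open>x \<in> I\<^sup>n \<inter> A\<close>.

  (i) For large \<open>m\<close>, \<open>xJ\<^sup>m \<subseteq> I\<^sup>n\<^sup>+\<^sup>m \<inter> A = J\<^sup>n\<^sup>+\<^sup>m\<close>.  At each prime \<open>J\<close> is generated by one
  non-zerodivisor \<open>j\<close>, which can be cancelled from \<open>xj\<^sup>m \<in> (j\<^sup>n\<^sup>+\<^sup>m)\<close>, so \<open>x \<in> J\<^sup>n\<close> locally, hence globally.

  (ii) The associated graded ring of \<open>J\<close> is a polynomial ring over the reduced ring \<open>A/J\<close>, so it is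
  reduced.  If \<open>x \<in> J\<^sup>k\<close> with \<open>k < n\<close>, then \<open>x\<^sup>m \<in> I\<^sup>n\<^sup>m \<inter> A = J\<^sup>n\<^sup>m \<subseteq> J\<^sup>k\<^sup>m\<^sup>+\<^sup>1\<close> for large \<open>m\<close>, so the class of
  \<open>x\<close> in degree \<open>k\<close> is nilpotent, and \<open>x \<in> J\<^sup>k\<^sup>+\<^sup>1\<close>.
\<close>

section \<open>Powers of ideals\<close>

lemma ideal_prod_mono:
  assumes "I \<subseteq> I'" "J \<subseteq> J'"
  shows "I \<cdot>\<^bsub>R\<^esub> J \<subseteq> I' \<cdot>\<^bsub>R\<^esub> J'"
proof
  fix s assume "s \<in> I \<cdot>\<^bsub>R\<^esub> J"
  then show "s \<in> I' \<cdot>\<^bsub>R\<^esub> J'"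
    by induction (use assms in \<open>auto intro: ideal_prod.intros\<close>)
qed

lemma ideal_pow_mono: "K \<subseteq> J \<Longrightarrow> ideal_pow R K n \<subseteq> ideal_pow R J n"
  by (induction n) (simp_all add: ideal_prod_mono)

context cring
begin

lemma ideal_ideal_pow: "ideal J R \<Longrightarrow> ideal (ideal_pow R J n) R"
  by (induction n) (auto intro: oneideal ideal_prod_is_ideal)

lemma ideal_pow_1: "ideal J R \<Longrightarrow> ideal_pow R J (Suc 0) = J"
  by (simp add: ideal_prod_commute[OF oneideal] ideal_prod_one)

lemma ideal_pow_add:
  assumes "ideal J R"
  shows "ideal_pow R J (m + n) = ideal_pow R J m \<cdot> ideal_pow R J n"
proof -
  interpret M: comm_monoid "ideals_set R" by (rule ideals_set_is_comm_monoid)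
  show ?thesis
    using M.nat_pow_mult[of J m n] assms by (simp add: ideal_pow_def ideals_set_def)
qed

lemma ideal_pow_antimono:
  assumes "ideal J R" "m \<le> n"
  shows "ideal_pow R J n \<subseteq> ideal_pow R J m"
  using ideal_prod_inter[OF ideal_ideal_pow ideal_ideal_pow, OF assms(1) assms(1), of m "n - m"] assms
  by (simp add: ideal_pow_add[symmetric])

lemma mult_in_ideal_pow_add:
  assumes "ideal J R" "x \<in> ideal_pow R J m" "y \<in> ideal_pow R J n"
  shows "x \<otimes> y \<in> ideal_pow R J (m + n)"
  using assms by (simp add: ideal_pow_add ideal_prod.prod)

lemma nat_pow_in_ideal_pow:
  assumes "ideal J R" "x \<in> ideal_pow R J n"
  shows "x [^] (m::nat) \<in> ideal_pow R J (n * m)"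
proof (induction m)
  case (Suc m)
  then show ?case
    using mult_in_ideal_pow_add[OF assms(1) Suc assms(2)] by (simp add: add.commute)
qed simp

text \<open>The usual factorisation of a difference of powers: \<open>q\<close> is the sum of the
  products \<open>a^i b^(m-i)\<close>, each of which lies in \<open>J^(n*m)\<close>. It is the means
  of comparing powers of \<open>y\<close> with powers of its components in
  \<open>J_reduced\<close>.\<close>

lemma nat_pow_Suc_diff_factor:
  assumes J: "ideal J R" and a: "a \<in> ideal_pow R J n" and b: "b \<in> ideal_pow R J n"
  shows "\<exists>q \<in> ideal_pow R J (n * m). a [^] Suc m = b [^] Suc m \<oplus> (a \<ominus> b) \<otimes> q"
proof -
  have carr: "a \<in> carrier R" "b \<in> carrier R"
    using ideal.Icarr[OF ideal_ideal_pow[OF J]] a b by auto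
  show ?thesis
  proof (induction m)
    case 0
    have "b \<oplus> (a \<ominus> b) \<otimes> \<one> = a" using carr by algebra
    then show ?case using carr by (intro bexI[of _ \<one>]) simp_all
  next
    case (Suc m)
    then obtain q where q: "q \<in> ideal_pow R J (n * m)" "a [^] Suc m = b [^] Suc m \<oplus> (a \<ominus> b) \<otimes> q"
      by blast
    interpret P: ideal "ideal_pow R J (n * Suc m)" R by (rule ideal_ideal_pow[OF J])
    have qc: "q \<in> carrier R" using ideal.Icarr[OF ideal_ideal_pow[OF J] q(1)] .
    define c where "c = b [^] Suc m"
    have c: "c \<in> carrier R" unfolding c_def using carr by (intro nat_pow_closed)
    have "a [^] Suc (Suc m) = (c \<oplus> (a \<ominus> b) \<otimes> q) \<otimes> a"
      using q(2) by (simp add: c_def)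
    also have "\<dots> = c \<otimes> b \<oplus> (a \<ominus> b) \<otimes> (c \<oplus> q \<otimes> a)"
      using c qc carr by algebra
    finally have "a [^] Suc (Suc m) = b [^] Suc (Suc m) \<oplus> (a \<ominus> b) \<otimes> (c \<oplus> q \<otimes> a)"
      by (simp add: c_def)
    moreover have "c \<oplus> q \<otimes> a \<in> ideal_pow R J (n * Suc m)"
      using nat_pow_in_ideal_pow[OF J b, of "Suc m"] mult_in_ideal_pow_add[OF J q(1) a]
      by (intro P.a_closed) (simp_all add: c_def add.commute)
    ultimately show ?case by blast
  qed
qed


section \<open>Maximal ideals\<close>

lemma cring_idealI:
  assumes "I \<subseteq> carrier R" "\<zero> \<in> I"
    and add: "\<And>a b. a \<in> I \<Longrightarrow> b \<in> I \<Longrightarrow> a \<oplus> b \<in> I"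
    and mult: "\<And>r a. r \<in> carrier R \<Longrightarrow> a \<in> I \<Longrightarrow> r \<otimes> a \<in> I"
  shows "ideal I R"
proof (rule idealI)
  have "\<ominus> a \<in> I" if "a \<in> I" for a
    using mult[of "\<ominus> \<one>" a] that assms(1) by (simp add: l_minus subset_iff)
  then show "subgroup I (add_monoid R)"
    using assms(1,2) add by (intro add.subgroupI) (auto simp: a_inv_def)
  fix a r assume "a \<in> I" "r \<in> carrier R"
  then show "r \<otimes> a \<in> I" "a \<otimes> r \<in> I"
    using mult[of r a] assms(1) by (auto simp: m_comm subset_iff)
qed (rule ring_axioms)

lemma exists_maximalideal:
  assumes I: "ideal I R" "I \<noteq> carrier R"
  obtains M where "maximalideal M R" "I \<subseteq> M"
proof -
  \<comment> \<open>Properness is recorded as \<open>\<one> \<notin> J\<close>, a condition that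
    passes at once to unions of chains.\<close>
  define F where "F = {J. ideal J R \<and> I \<subseteq> J \<and> \<one> \<notin> J}"
  have "\<exists>M\<in>F. \<forall>X\<in>F. M \<subseteq> X \<longrightarrow> X = M"
  proof (rule subset_Zorn_nonempty)
    show "F \<noteq> {}" using I ideal.one_imp_carrier unfolding F_def by blast
    fix C assume C: "C \<noteq> {}" "subset.chain F C"
    have CF: "C \<subseteq> F" and tot: "\<And>X Y. X \<in> C \<Longrightarrow> Y \<in> C \<Longrightarrow> X \<subseteq> Y \<or> Y \<subseteq> X"
      using C(2) by (auto simp: subset_chain_def)
    have id: "ideal X R" if "X \<in> C" for X using that CF by (auto simp: F_def)
    have "ideal (\<Union>C) R"
    proof (rule cring_idealI)
      show "\<Union>C \<subseteq> carrier R" using ideal.Icarr[OF id] by blast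
      show "\<zero> \<in> \<Union>C"
        using C(1) additive_subgroup.zero_closed[OF ideal.axioms(1)[OF id]] by blast
      fix a assume a: "a \<in> \<Union>C"
      show "r \<otimes> a \<in> \<Union>C" if "r \<in> carrier R" for r
        using a ideal.I_l_closed[OF id _ that] by blast
      fix b assume "b \<in> \<Union>C"
      with a obtain X where "X \<in> C" "a \<in> X" "b \<in> X" using tot by blast
      then show "a \<oplus> b \<in> \<Union>C"
        using additive_subgroup.a_closed[OF ideal.axioms(1)[OF id]] by blast
    qed
    then show "\<Union>C \<in> F" using CF C(1) by (auto simp: F_def)
  qed
  then obtain M where M: "M \<in> F" "\<And>X. X \<in> F \<Longrightarrow> M \<subseteq> X \<Longrightarrow> X = M" by blast
  have "maximalideal M R"
  proof (rule maximalidealI)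
    show "ideal M R" "carrier R \<noteq> M" using M(1) by (auto simp: F_def)
    fix X assume "ideal X R" "M \<subseteq> X" "X \<subseteq> carrier R"
    then show "X = M \<or> X = carrier R"
      using M ideal.one_imp_carrier by (fastforce simp: F_def)
  qed
  with M(1) that show thesis by (auto simp: F_def)
qed

text \<open>The multipliers that carry \<open>x\<close> into \<open>K\<close> form an ideal
  \<open>Q\<close>, the colon ideal of \<open>x\<close> into \<open>K\<close>. If \<open>Q\<close>
  were proper, it would lie in a maximal ideal, and the hypothesis at that prime would give an
  element of \<open>Q\<close> outside it.\<close>

lemma mem_ideal_locally:
  assumes K: "ideal K R" and x: "x \<in> carrier R"
    and loc: "\<And>P. primeideal P R \<Longrightarrow> \<exists>s \<in> carrier R - P. s \<otimes> x \<in> K"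
  shows "x \<in> K"
proof -
  interpret K: ideal K R by (rule K)
  define Q where "Q = {s \<in> carrier R. s \<otimes> x \<in> K}"
  have "ideal Q R"
    by (rule cring_idealI) (use x in \<open>auto simp: Q_def l_distr m_assoc intro: K.I_l_closed\<close>)
  have "Q = carrier R"
  proof (rule ccontr)
    assume "Q \<noteq> carrier R"
    with \<open>ideal Q R\<close> obtain M where "maximalideal M R" "Q \<subseteq> M"
      by (rule exists_maximalideal)
    then show False using loc[OF maximalideal_prime] by (auto simp: Q_def)
  qed
  then have "\<one> \<in> Q" by simp
  then show ?thesis using x by (simp add: Q_def)
qed


section \<open>Regular sequences\<close>

text \<open>The class of \<open>w\<close> is a non-zerodivisor in the quotient by \<open>L\<close>,
  phrased with elements of \<open>R\<close> to avoid computing with cosets.\<close>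

definition nzd_mod :: "'a set \<Rightarrow> 'a \<Rightarrow> bool" where
  "nzd_mod L w \<longleftrightarrow> w \<in> carrier R \<and> (\<forall>a \<in> carrier R. w \<otimes> a \<in> L \<longrightarrow> a \<in> L)"

text \<open>
  If \<open>K\<close> is generated by a regular sequence and \<open>K \<subseteq> L\<close>, then \<open>\<Oplus>\<^sub>n K\<^sup>n/LK\<^sup>n\<close> is a polynomial ring over
  \<open>R/L\<close>.  The following two properties express, without polynomials, that non-zerodivisors of \<open>R/L\<close>
  stay non-zerodivisors on this ring and that it is reduced if \<open>R/L\<close> is.  Allowing all \<open>L \<supseteq> K\<close>, not
  just \<open>L = K\<close>, is what makes the induction on the length of the sequence work.
\<close>

definition ideal_pow_cancel :: "'a set \<Rightarrow> bool" where
  "ideal_pow_cancel K \<longleftrightarrow> (\<forall>L w n y. ideal L R \<longrightarrow> K \<subseteq> L \<longrightarrow> nzd_mod L w \<longrightarrow>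
     y \<in> ideal_pow R K n \<longrightarrow> w \<otimes> y \<in> L \<cdot> ideal_pow R K n \<longrightarrow> y \<in> L \<cdot> ideal_pow R K n)"

definition ideal_pow_reduced :: "'a set \<Rightarrow> bool" where
  "ideal_pow_reduced K \<longleftrightarrow> (\<forall>L n m y. radical_ideal R L \<longrightarrow> K \<subseteq> L \<longrightarrow> y \<in> ideal_pow R K n \<longrightarrow>
     y [^] Suc m \<in> L \<cdot> ideal_pow R K (n * Suc m) \<longrightarrow> y \<in> L \<cdot> ideal_pow R K n)"

text \<open>Since \<open>K^(n+1) = K \<cdot> K^n\<close>, the cancellation property with
  \<open>L = K\<close> lifts membership from \<open>K^n\<close> to \<open>K^(n+1)\<close>; induction
  starts from \<open>K^0 = R\<close>.\<close>

lemma nzd_mod_ideal_pow: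
  assumes K: "ideal K R" "ideal_pow_cancel K" and z: "nzd_mod K z"
    and y: "y \<in> carrier R" "z \<otimes> y \<in> ideal_pow R K n"
  shows "y \<in> ideal_pow R K n"
  using y
proof (induction n)
  case (Suc n)
  have comm: "ideal_pow R K (Suc n) = K \<cdot> ideal_pow R K n"
    using K(1) by (simp add: ideal_prod_commute ideal_ideal_pow)
  have "z \<otimes> y \<in> ideal_pow R K n"
    using Suc.prems(2) ideal_pow_antimono[OF K(1), of n "Suc n"] by auto
  with Suc have "y \<in> ideal_pow R K n" by blast
  then show ?case
    using K z Suc.prems(2) unfolding comm ideal_pow_cancel_def by blast
qed simp

lemma radical_idealD:
  assumes "radical_ideal R L" "y \<in> carrier R" "y [^] Suc m \<in> L"
  shows "y \<in> L"
proof -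
  have "y \<in> radical R L" using assms(2,3) unfolding radical_def by force
  then show ?thesis using assms(1) by (simp add: radical_ideal_def)
qed

end

section \<open>Adjoining one generator to an ideal\<close>

locale adjoin_generator = cring +
  fixes K L z J
  assumes K: "ideal K R" and L: "ideal L R" and z: "z \<in> carrier R"
    and J_eq: "J = K <+>\<^bsub>R\<^esub> PIdl z" and JL: "J \<subseteq> L"
begin

lemma J_ideal: "ideal J R"
  unfolding J_eq by (intro add_ideals K cgenideal_ideal z)

lemma K_subset_J: "K \<subseteq> J" and z_in_J: "z \<in> J"
proof -
  show "K \<subseteq> J"
    unfolding J_eq union_genideal[OF K cgenideal_ideal[OF z], symmetric]
    using genideal_self[of "K \<union> PIdl z"] ideal.Icarr[OF K] ideal.Icarr[OF cgenideal_ideal[OF z]]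
    by blast
  show "z \<in> J"
    unfolding J_eq union_genideal[OF K cgenideal_ideal[OF z], symmetric]
    using genideal_self[of "K \<union> PIdl z"] ideal.Icarr[OF K] ideal.Icarr[OF cgenideal_ideal[OF z]]
      cgenideal_self[OF z]
    by blast
qed

lemma J_split:
  assumes "y \<in> J"
  obtains k r where "k \<in> K" "r \<in> carrier R" "y = k \<oplus> z \<otimes> r"
  using assms z by (auto simp: J_eq set_add_def' cgenideal_def m_comm[of z])

lemmas JP_ideal = ideal_ideal_pow[OF J_ideal] and KP_ideal = ideal_ideal_pow[OF K]
lemmas LJP_ideal = ideal_prod_is_ideal[OF L JP_ideal] and LKP_ideal = ideal_prod_is_ideal[OF L KP_ideal]
lemmas JP_carr = ideal.Icarr[OF JP_ideal] and KP_carr = ideal.Icarr[OF KP_ideal]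
  and LJP_carr = ideal.Icarr[OF LJP_ideal] and LKP_carr = ideal.Icarr[OF LKP_ideal]

text \<open>In a product of elements \<open>k + z r\<close> of \<open>J\<close>, the only term
  without a factor \<open>z\<close> is the product of the components in \<open>K\<close>.\<close>

lemma ideal_pow_split:
  "y \<in> ideal_pow R J (Suc n) \<Longrightarrow>
   \<exists>k \<in> ideal_pow R K (Suc n). \<exists>u \<in> ideal_pow R J n. y = k \<oplus> z \<otimes> u"
proof (induction n arbitrary: y)
  case 0
  then have "y \<in> J" by (simp only: ideal_pow_1[OF J_ideal])
  then show ?case
    unfolding ideal_pow_1[OF K] by (rule J_split) auto
next
  case (Suc n)
  have "y \<in> ideal_pow R J (Suc n) \<cdot> J" using Suc.prems by simp
  then show ?case
  proof (induction y)
    case (prod i j)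
    obtain k u where i: "k \<in> ideal_pow R K (Suc n)" "u \<in> ideal_pow R J n" "i = k \<oplus> z \<otimes> u"
      using Suc.IH[OF prod(1)] by blast
    obtain k' r where j: "k' \<in> K" "r \<in> carrier R" "j = k' \<oplus> z \<otimes> r"
      using J_split[OF prod(2)] .
    have kk: "k \<otimes> k' \<in> ideal_pow R K (Suc (Suc n))"
      using i(1) j(1) unfolding ideal_pow_Suc[of _ _ "Suc n"] by (rule ideal_prod.prod)
    have uk: "u \<otimes> k' \<in> ideal_pow R J (Suc n)"
      using i(2) j(1) K_subset_J unfolding ideal_pow_Suc by (blast intro: ideal_prod.prod)
    have ir: "r \<otimes> i \<in> ideal_pow R J (Suc n)"
      using ideal.I_l_closed[OF JP_ideal prod(1) j(2)] .
    \<comment> \<open>The factor \<open>i\<close> is expanded only against \<open>k'\<close> and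
      kept whole against \<open>z \<otimes> r\<close>, so both cofactors of \<open>z\<close> stay in
      \<open>J^(n+1)\<close>.\<close>
    have "i \<otimes> j = k \<otimes> k' \<oplus> z \<otimes> (u \<otimes> k' \<oplus> r \<otimes> i)"
    proof -
      have "i \<otimes> (k' \<oplus> z \<otimes> r) = i \<otimes> k' \<oplus> z \<otimes> (r \<otimes> i)"
        using JP_carr[OF prod(1)] ideal.Icarr[OF K j(1)] j(2) z by algebra
      also have "i \<otimes> k' = k \<otimes> k' \<oplus> z \<otimes> (u \<otimes> k')"
        unfolding i(3) using KP_carr[OF i(1)] JP_carr[OF i(2)] ideal.Icarr[OF K j(1)] z by algebra
      finally show ?thesis
        unfolding j(3)
        using KP_carr[OF kk] JP_carr[OF uk] JP_carr[OF ir] z by (simp add: r_distr a_assoc)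
    qed
    then show ?case
      using kk uk ir additive_subgroup.a_closed[OF ideal.axioms(1)[OF JP_ideal]] by blast
  next
    case (sum s t)
    obtain k u where s: "k \<in> ideal_pow R K (Suc (Suc n))" "u \<in> ideal_pow R J (Suc n)" "s = k \<oplus> z \<otimes> u"
      using sum.IH(1) by blast
    obtain k' u' where t: "k' \<in> ideal_pow R K (Suc (Suc n))" "u' \<in> ideal_pow R J (Suc n)"
      "t = k' \<oplus> z \<otimes> u'"
      using sum.IH(2) by blast
    have "s \<oplus> t = (k \<oplus> k') \<oplus> z \<otimes> (u \<oplus> u')"
      unfolding s(3) t(3)
      using KP_carr[OF s(1)] KP_carr[OF t(1)] JP_carr[OF s(2)] JP_carr[OF t(2)] z by algebra
    then show ?case
      using s t additive_subgroup.a_closed[OF ideal.axioms(1)[OF JP_ideal]]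
        additive_subgroup.a_closed[OF ideal.axioms(1)[OF KP_ideal]] by blast
  qed
qed

lemma ideal_prod_pow_split:
  assumes "y \<in> L \<cdot> ideal_pow R J (Suc n)"
  shows "\<exists>k \<in> L \<cdot> ideal_pow R K (Suc n). \<exists>u \<in> L \<cdot> ideal_pow R J n. y = k \<oplus> z \<otimes> u"
  using assms
proof (induction y)
  case (prod l i)
  obtain k u where i: "k \<in> ideal_pow R K (Suc n)" "u \<in> ideal_pow R J n" "i = k \<oplus> z \<otimes> u"
    using ideal_pow_split[OF prod(2)] by blast
  have "l \<otimes> i = l \<otimes> k \<oplus> z \<otimes> (l \<otimes> u)"
    unfolding i(3) using ideal.Icarr[OF L prod(1)] KP_carr[OF i(1)] JP_carr[OF i(2)] z by algebra
  then show ?case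
    using ideal_prod.prod[OF prod(1) i(1), of R] ideal_prod.prod[OF prod(1) i(2), of R] by blast
next
  case (sum s t)
  obtain k u where s: "k \<in> L \<cdot> ideal_pow R K (Suc n)" "u \<in> L \<cdot> ideal_pow R J n" "s = k \<oplus> z \<otimes> u"
    using sum.IH(1) by blast
  obtain k' u' where t: "k' \<in> L \<cdot> ideal_pow R K (Suc n)" "u' \<in> L \<cdot> ideal_pow R J n"
    "t = k' \<oplus> z \<otimes> u'"
    using sum.IH(2) by blast
  have "s \<oplus> t = (k \<oplus> k') \<oplus> z \<otimes> (u \<oplus> u')"
    unfolding s(3) t(3)
    using LKP_carr[OF s(1)] LKP_carr[OF t(1)] LJP_carr[OF s(2)] LJP_carr[OF t(2)] z by algebra
  then show ?case
    using ideal_prod.sum[OF s(1) t(1)] ideal_prod.sum[OF s(2) t(2)] by blast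
qed

text \<open>Converse of \<open>ideal_prod_pow_split\<close>, used to reassemble an element once both
  of its components have been treated.\<close>

lemma ideal_prod_pow_join:
  assumes "k \<in> L \<cdot> ideal_pow R K (Suc n)" "u \<in> L \<cdot> ideal_pow R J n"
  shows "k \<oplus> z \<otimes> u \<in> L \<cdot> ideal_pow R J (Suc n)"
proof (rule ideal_prod.sum)
  show "k \<in> L \<cdot> ideal_pow R J (Suc n)"
    using assms(1) ideal_prod_mono[OF order_refl ideal_pow_mono[OF K_subset_J]] by blast
  have "u \<otimes> z \<in> (L \<cdot> ideal_pow R J n) \<cdot> J"
    using assms(2) z_in_J by (rule ideal_prod.prod)
  then show "z \<otimes> u \<in> L \<cdot> ideal_pow R J (Suc n)"
    using ideal_prod_assoc[OF L JP_ideal J_ideal] m_comm[OF z LJP_carr[OF assms(2)]] by simp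
qed

text \<open>The decomposition \<open>J\<^sup>n\<^sup>+\<^sup>1 = K\<^sup>n\<^sup>+\<^sup>1 + zJ\<^sup>n\<close> is direct modulo \<open>LJ\<^sup>n\<^sup>+\<^sup>1\<close>.\<close>

lemma ideal_prod_pow_cancel:
  assumes K_cancel: "ideal_pow_cancel K" and nzd: "nzd_mod K z"
    and k: "k \<in> ideal_pow R K (Suc n)" and u: "u \<in> ideal_pow R J n"
    and ku: "k \<oplus> z \<otimes> u \<in> L \<cdot> ideal_pow R J (Suc n)"
  shows "k \<in> L \<cdot> ideal_pow R K (Suc n)" "u \<in> L \<cdot> ideal_pow R J n"
proof -
  obtain l m where l: "l \<in> L \<cdot> ideal_pow R K (Suc n)" and m: "m \<in> L \<cdot> ideal_pow R J n"
    and eq: "k \<oplus> z \<otimes> u = l \<oplus> z \<otimes> m"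
    using ideal_prod_pow_split[OF ku] by blast
  have carr: "k \<in> carrier R" "u \<in> carrier R" "l \<in> carrier R" "m \<in> carrier R"
    using KP_carr[OF k] JP_carr[OF u] LKP_carr[OF l] LJP_carr[OF m] .
  \<comment> \<open>Two decompositions of the same element are compared:
    \<open>z \<otimes> d = l \<ominus> k\<close> lies in \<open>K^(n+1)\<close>, hence so does
    \<open>d\<close>, because \<open>z\<close> is a non-zerodivisor modulo that power. Reading
    \<open>K^(n+1)\<close> as \<open>K \<cdot> K^n\<close> settles \<open>u\<close>; using
    \<open>z\<close> as the factor from \<open>L\<close> settles \<open>k\<close>.\<close>
  define d where "d = u \<ominus> m"
  have d: "d \<in> carrier R" unfolding d_def using carr by algebra
  interpret KP: ideal "ideal_pow R K (Suc n)" R by (rule KP_ideal)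
  interpret LKP: ideal "L \<cdot> ideal_pow R K (Suc n)" R by (rule LKP_ideal)
  interpret LJP: ideal "L \<cdot> ideal_pow R J n" R by (rule LJP_ideal)
  have "z \<otimes> d = (k \<oplus> z \<otimes> u) \<ominus> k \<ominus> z \<otimes> m"
    unfolding d_def using carr z by algebra
  also have "\<dots> = l \<ominus> k" unfolding eq using carr z by algebra
  finally have zd: "z \<otimes> d = l \<ominus> k" .
  have "l \<in> ideal_pow R K (Suc n)"
    using l ideal_prod_inter[OF L KP_ideal] by blast
  then have "z \<otimes> d \<in> ideal_pow R K (Suc n)"
    unfolding zd minus_eq using k by (intro KP.a_closed KP.a_inv_closed)
  then have dK: "d \<in> ideal_pow R K (Suc n)"
    by (rule nzd_mod_ideal_pow[OF K K_cancel nzd d])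
  then have "d \<in> K \<cdot> ideal_pow R K n"
    by (simp add: ideal_prod_commute[OF KP_ideal K])
  then have "d \<in> L \<cdot> ideal_pow R J n"
    using ideal_prod_mono[OF order_trans[OF K_subset_J JL] ideal_pow_mono[OF K_subset_J]] by blast
  moreover have "u = d \<oplus> m" unfolding d_def using carr by algebra
  ultimately show "u \<in> L \<cdot> ideal_pow R J n" using m by simp
  have "z \<otimes> d \<in> L \<cdot> ideal_pow R K (Suc n)"
    using z_in_J JL dK by (blast intro: ideal_prod.prod)
  moreover have "k = l \<ominus> z \<otimes> d" unfolding zd using carr by algebra
  ultimately show "k \<in> L \<cdot> ideal_pow R K (Suc n)"
    using LKP.a_closed[OF l LKP.a_inv_closed] by (simp only: minus_eq)
qed

text \<open>Induction on the degree. Multiplication by \<open>w\<close> respects the decomposition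
  \<open>y = k + z u\<close>, so directness separates the two components: the first is handled by
  the cancellation property of \<open>K\<close>, the second by the induction hypothesis. Degree 0 is
  the assumption on \<open>w\<close>.\<close>

lemma J_cancel:
  assumes K_cancel: "ideal_pow_cancel K" and z_nzd: "nzd_mod K z" and w: "nzd_mod L w"
    and y: "y \<in> ideal_pow R J n" "w \<otimes> y \<in> L \<cdot> ideal_pow R J n"
  shows "y \<in> L \<cdot> ideal_pow R J n"
  using y
proof (induction n arbitrary: y)
  case 0
  then show ?case using w by (simp add: ideal_prod_one[OF L] nzd_mod_def)
next
  case (Suc n)
  have wc: "w \<in> carrier R" using w by (simp add: nzd_mod_def)
  obtain k u where k: "k \<in> ideal_pow R K (Suc n)" and u: "u \<in> ideal_pow R J n"
    and y_eq: "y = k \<oplus> z \<otimes> u"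
    using ideal_pow_split[OF Suc.prems(1)] by blast
  have "w \<otimes> y = w \<otimes> k \<oplus> z \<otimes> (w \<otimes> u)"
    unfolding y_eq using wc z KP_carr[OF k] JP_carr[OF u] by algebra
  then have "w \<otimes> k \<oplus> z \<otimes> (w \<otimes> u) \<in> L \<cdot> ideal_pow R J (Suc n)"
    using Suc.prems(2) by simp
  note * = ideal_prod_pow_cancel[OF K_cancel z_nzd ideal.I_l_closed[OF KP_ideal k wc]
      ideal.I_l_closed[OF JP_ideal u wc] this]
  have "k \<in> L \<cdot> ideal_pow R K (Suc n)"
    using K_cancel L w k *(1) order_trans[OF K_subset_J JL] unfolding ideal_pow_cancel_def by blast
  then show ?case
    unfolding y_eq using Suc.IH[OF u *(2)] by (rule ideal_prod_pow_join)
qed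

text \<open>Induction on the degree, with \<open>y = k + z u\<close>. Modulo multiples of
  \<open>z\<close> the power of \<open>y\<close> is that of \<open>k\<close>, so directness and
  reducedness for \<open>K\<close> put \<open>k\<close> in \<open>L \<cdot> K^(n+1)\<close>. Then
  \<open>k\<close> may be dropped, the power of \<open>z u\<close> lies in the required product, and
  cancelling the factors \<open>z\<close> leaves the induction hypothesis for
  \<open>u\<close>.\<close>

lemma J_reduced:
  assumes K_cancel: "ideal_pow_cancel K" and K_red: "ideal_pow_reduced K" and z_nzd: "nzd_mod K z"
    and rad: "radical_ideal R L"
    and y: "y \<in> ideal_pow R J n" "y [^] Suc m \<in> L \<cdot> ideal_pow R J (n * Suc m)"
  shows "y \<in> L \<cdot> ideal_pow R J n"
  using y
proof (induction n arbitrary: y)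
  case 0
  then show ?case using radical_idealD[OF rad, of y m] by (simp add: ideal_prod_one[OF L])
next
  case (Suc n)
  obtain k u where k: "k \<in> ideal_pow R K (Suc n)" and u: "u \<in> ideal_pow R J n"
    and y_eq: "y = k \<oplus> z \<otimes> u"
    using ideal_pow_split[OF Suc.prems(1)] by blast
  note carr = KP_carr[OF k] JP_carr[OF u] JP_carr[OF Suc.prems(1)] z
  have kJ: "k \<in> ideal_pow R J (Suc n)" using k ideal_pow_mono[OF K_subset_J] by blast
  have zuJ: "z \<otimes> u \<in> ideal_pow R J (Suc n)"
    using ideal_prod.prod[OF u z_in_J, of R] by (simp add: m_comm carr)
  have "k \<in> L \<cdot> ideal_pow R K (Suc n)"
  proof -
    obtain q where q: "q \<in> ideal_pow R J (Suc n * m)"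
      "y [^] Suc m = k [^] Suc m \<oplus> (y \<ominus> k) \<otimes> q"
      using nat_pow_Suc_diff_factor[OF J_ideal Suc.prems(1) kJ] by blast
    have "(y \<ominus> k) \<otimes> q = z \<otimes> (u \<otimes> q)"
      unfolding y_eq using carr JP_carr[OF q(1)] by algebra
    \<comment> \<open>The splitting concerns exponents of the form \<open>Suc N\<close>; the
      cofactor \<open>u \<otimes> q\<close> of \<open>z\<close> has degree exactly one less than the
      total.\<close>
    moreover obtain N where N: "Suc n * Suc m = Suc N" "n + Suc n * m = N" by simp
    moreover have "u \<otimes> q \<in> ideal_pow R J (n + Suc n * m)"
      by (rule mult_in_ideal_pow_add[OF J_ideal u q(1)])
    moreover have "k [^] Suc m \<in> ideal_pow R K (Suc n * Suc m)"
      by (rule nat_pow_in_ideal_pow[OF K k])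
    ultimately have "k [^] Suc m \<in> L \<cdot> ideal_pow R K (Suc n * Suc m)"
      using ideal_prod_pow_cancel(1)[OF K_cancel z_nzd, of "k [^] Suc m" N "u \<otimes> q"] q(2) Suc.prems(2)
      by metis
    then show ?thesis
      using K_red rad k order_trans[OF K_subset_J JL] unfolding ideal_pow_reduced_def by blast
  qed
  moreover have "u \<in> L \<cdot> ideal_pow R J n"
  proof (rule Suc.IH[OF u])
    interpret LJP: ideal "L \<cdot> ideal_pow R J (Suc n * Suc m)" R by (rule LJP_ideal)
    obtain q where q: "q \<in> ideal_pow R J (Suc n * m)"
      "(z \<otimes> u) [^] Suc m = y [^] Suc m \<oplus> (z \<otimes> u \<ominus> y) \<otimes> q"
      using nat_pow_Suc_diff_factor[OF J_ideal zuJ Suc.prems(1)] by blast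
    have "(z \<otimes> u \<ominus> y) \<otimes> q = \<ominus> (k \<otimes> q)"
      unfolding y_eq using carr JP_carr[OF q(1)] by algebra
    moreover have "k \<otimes> q \<in> L \<cdot> ideal_pow R J (Suc n * Suc m)"
    proof -
      have "k \<in> L \<cdot> ideal_pow R J (Suc n)"
        using \<open>k \<in> L \<cdot> ideal_pow R K (Suc n)\<close> ideal_prod_mono[OF order_refl ideal_pow_mono[OF K_subset_J]]
        by blast
      then have "k \<otimes> q \<in> (L \<cdot> ideal_pow R J (Suc n)) \<cdot> ideal_pow R J (Suc n * m)"
        using q(1) by (rule ideal_prod.prod)
      then show ?thesis
        by (simp only: ideal_prod_assoc[OF L JP_ideal JP_ideal] ideal_pow_add[OF J_ideal, symmetric]
            mult_Suc_right)
    qed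
    ultimately have *: "(z \<otimes> u) [^] Suc m \<in> L \<cdot> ideal_pow R J (Suc n * Suc m)"
      unfolding q(2) using LJP.a_closed[OF Suc.prems(2)] LJP.a_inv_closed by simp
    \<comment> \<open>Multiplication by \<open>z\<close> is injective from \<open>J^N\<close> modulo
      \<open>L \<cdot> J^N\<close> into the next degree, by directness with component zero in
      \<open>K\<close>; this is iterated \<open>i\<close> times.\<close>
    have drop: "v \<in> L \<cdot> ideal_pow R J N"
      if "v \<in> ideal_pow R J N" "z [^] i \<otimes> v \<in> L \<cdot> ideal_pow R J (N + i)" for i N v
      using that(2)
    proof (induction i)
      case 0
      then show ?case using JP_carr[OF that(1)] by simp
    next
      case (Suc i)
      let ?v = "z [^] i \<otimes> v"
      have vc: "v \<in> carrier R" using JP_carr[OF that(1)] .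
      have "z [^] i \<in> ideal_pow R J i"
        using nat_pow_in_ideal_pow[OF J_ideal, of z "Suc 0" i] z_in_J
        by (simp only: ideal_pow_1[OF J_ideal]) simp
      then have "?v \<in> ideal_pow R J (N + i)"
        using mult_in_ideal_pow_add[OF J_ideal _ that(1), of "z [^] i" i] by (simp add: add.commute)
      moreover have "\<zero> \<oplus> z \<otimes> ?v = z [^] Suc i \<otimes> v"
        using vc z by (simp add: m_ac)
      moreover have "\<zero> \<in> ideal_pow R K (Suc (N + i))"
        by (rule additive_subgroup.zero_closed[OF ideal.axioms(1)[OF KP_ideal]])
      ultimately have "?v \<in> L \<cdot> ideal_pow R J (N + i)"
        using Suc.prems ideal_prod_pow_cancel(2)[OF K_cancel z_nzd, of \<zero> "N + i" ?v] by simp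
      then show ?case by (rule Suc.IH)
    qed
    have "(z \<otimes> u) [^] Suc m = z [^] Suc m \<otimes> u [^] Suc m"
      using carr by (intro nat_pow_distrib)
    moreover have "Suc n * Suc m = n * Suc m + Suc m" by simp
    ultimately show "u [^] Suc m \<in> L \<cdot> ideal_pow R J (n * Suc m)"
      using drop[OF nat_pow_in_ideal_pow[OF J_ideal u], of "Suc m" "Suc m"] * by (simp only:)
  qed
  ultimately show ?case unfolding y_eq by (rule ideal_prod_pow_join)
qed

end

section \<open>Induction along a regular sequence\<close>

context cring
begin

lemma ideal_pow_zero_ideal: "ideal_pow R {\<zero>} (Suc n) = {\<zero>}"
  by (simp add: ideal_prod_zero[OF ideal_ideal_pow[OF zeroideal]])

text \<open>Base case, the empty sequence: degree 0 is the hypothesis on \<open>w\<close>, and all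
  higher powers vanish.\<close>

lemma ideal_pow_cancel_zero: "ideal_pow_cancel {\<zero>}"
  unfolding ideal_pow_cancel_def
proof (intro allI impI)
  fix L w n y assume L: "ideal L R" "nzd_mod L w"
    and y: "y \<in> ideal_pow R {\<zero>} n" "w \<otimes> y \<in> L \<cdot> ideal_pow R {\<zero>} n"
  show "y \<in> L \<cdot> ideal_pow R {\<zero>} n"
  proof (cases n)
    case 0
    with L y show ?thesis by (simp add: ideal_prod_one nzd_mod_def)
  next
    case (Suc m)
    with L y show ?thesis by (simp only: ideal_pow_zero_ideal ideal_prod_zero)
  qed
qed

lemma ideal_pow_reduced_zero: "ideal_pow_reduced {\<zero>}"
  unfolding ideal_pow_reduced_def
proof (intro allI impI)
  fix L n m y assume L: "radical_ideal R L"
    and y: "y \<in> ideal_pow R {\<zero>} n" "y [^] Suc m \<in> L \<cdot> ideal_pow R {\<zero>} (n * Suc m)"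
  have id: "ideal L R" using L by (simp add: radical_ideal_def)
  show "y \<in> L \<cdot> ideal_pow R {\<zero>} n"
  proof (cases n)
    case 0
    with y show ?thesis using radical_idealD[OF L, of y m] by (simp add: ideal_prod_one[OF id])
  next
    case (Suc m)
    with id y show ?thesis by (simp only: ideal_pow_zero_ideal ideal_prod_zero)
  qed
qed

lemma nonzerodivisor_Quot:
  assumes L: "ideal L R" and w: "w \<in> carrier R" and nzd: "nonzerodivisor (R Quot L) (L +> w)"
  shows "nzd_mod L w"
  unfolding nzd_mod_def
proof (intro conjI ballI impI)
  interpret L: ideal L R by (rule L)
  fix a assume a: "a \<in> carrier R" and wa: "w \<otimes> a \<in> L"
  have "(L +> w) \<otimes>\<^bsub>R Quot L\<^esub> (L +> a) = L +> (w \<otimes> a)"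
    using L.rcoset_mult_add[OF w a] by (simp add: FactRing_def)
  also have "\<dots> = \<zero>\<^bsub>R Quot L\<^esub>" using a_rcos_zero[OF L wa] by (simp add: FactRing_def)
  finally have "L +> a = \<zero>\<^bsub>R Quot L\<^esub>"
    using nzd a a_rcosetsI[OF L.a_subset a] unfolding nonzerodivisor_def by (simp add: FactRing_def)
  then show "a \<in> L" using L.rcos_const_imp_mem[OF a] by (simp add: FactRing_def)
qed (rule w)

text \<open>Regularity is a condition on prefixes, so the induction appends at the end. Both
  properties are proved together because reducedness for the longer sequence uses cancellation for
  the shorter one.\<close>

lemma regular_imp_cancel_reduced:
  assumes "set xs \<subseteq> carrier R"
    and "\<forall>i<length xs. nzd_mod (Idl (set (take i xs))) (xs ! i)"
  shows "ideal_pow_cancel (Idl (set xs)) \<and> ideal_pow_reduced (Idl (set xs))"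
  using assms
proof (induction xs rule: rev_induct)
  case Nil
  have "Idl {} = {\<zero>}"
    using genideal_minimal[OF zeroideal, of "{}"]
      additive_subgroup.zero_closed[OF ideal.axioms(1)[OF genideal_ideal[of "{}"]]] by auto
  then show ?case using ideal_pow_cancel_zero ideal_pow_reduced_zero by simp
next
  case (snoc z xs)
  define K where "K = Idl (set xs)"
  define J where "J = K <+>\<^bsub>R\<^esub> PIdl z"
  have z: "z \<in> carrier R" and xs: "set xs \<subseteq> carrier R" using snoc.prems by auto
  have K: "ideal K R" unfolding K_def by (rule genideal_ideal[OF xs])
  have "\<forall>i<length xs. nzd_mod (Idl (set (take i xs))) (xs ! i)"
  proof (intro allI impI)
    fix i assume "i < length xs"
    then show "nzd_mod (Idl (set (take i xs))) (xs ! i)"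
      using snoc.prems(2)[rule_format, of i] by (simp add: nth_append)
  qed
  with snoc.IH[OF xs] have KC: "ideal_pow_cancel K" and KR: "ideal_pow_reduced K"
    unfolding K_def by auto
  have zK: "nzd_mod K z" using snoc.prems(2)[rule_format, of "length xs"] by (simp add: K_def)
  \<comment> \<open>\<open>L\<close> stays arbitrary above \<open>J\<close>, as both properties
    quantify over it; those of \<open>K\<close> apply to the same \<open>L\<close>.\<close>
  have adj: "adjoin_generator R K L z J" if "ideal L R" "J \<subseteq> L" for L
    using that
    by (intro adjoin_generator.intro adjoin_generator_axioms.intro is_cring K z J_def)
  have Ji: "ideal J R" unfolding J_def by (rule add_ideals[OF K cgenideal_ideal[OF z]])
  interpret JJ: adjoin_generator R K J z J by (rule adj[OF Ji order_refl])
  have J: "Idl (set (xs @ [z])) = J"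
  proof
    show "Idl (set (xs @ [z])) \<subseteq> J"
      using genideal_minimal[OF Ji] genideal_self[OF xs] JJ.K_subset_J JJ.z_in_J
      unfolding K_def by auto
    have A: "ideal (Idl (set (xs @ [z]))) R" using xs z by (intro genideal_ideal) auto
    have "set (xs @ [z]) \<subseteq> Idl (set (xs @ [z]))" using xs z by (intro genideal_self) auto
    then have "K \<union> PIdl z \<subseteq> Idl (set (xs @ [z]))"
      using genideal_minimal[OF A, of "set xs"] cgenideal_minimal[OF A, of z] unfolding K_def by auto
    then show "J \<subseteq> Idl (set (xs @ [z]))"
      unfolding J_def union_genideal[OF K cgenideal_ideal[OF z], symmetric]
      by (rule genideal_minimal[OF A])
  qed
  have "ideal_pow_cancel J"
    unfolding ideal_pow_cancel_def using adjoin_generator.J_cancel[OF adj KC zK] by blast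
  moreover have "ideal_pow_reduced J"
    unfolding ideal_pow_reduced_def
  proof (intro allI impI)
    fix L n m y assume L: "radical_ideal R L" "J \<subseteq> L" and y: "y \<in> ideal_pow R J n"
      "y [^] Suc m \<in> L \<cdot> ideal_pow R J (n * Suc m)"
    have "ideal L R" using L(1) by (simp add: radical_ideal_def)
    then show "y \<in> L \<cdot> ideal_pow R J n"
      by (rule adjoin_generator.J_reduced[OF adj[OF _ L(2)] KC KR zK L(1) y])
  qed
  ultimately show ?case by (simp only: J)
qed

end

section \<open>Locally free modules of rank one\<close>

lemma carrier_loc_module: "X \<in> carrier (loc_module R S M) \<longleftrightarrow> (\<exists>m\<in>carrier M. \<exists>s\<in>S. X = frac R S M m s)"
  by (auto simp: loc_module_def quotient_def frac_def)

text \<open>Enough structure on the localization to evaluate the one-term sums that occur in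
  \<open>free_of_rank\<close> for rank one.\<close>

lemma loc_module_abelian_monoid:
  assumes M: "module R M" and S: "submonoid S R"
  shows "abelian_monoid (loc_module R S M)"
proof -
  interpret module R M by (rule M)
  note S_mult = loc_S_mult[OF M S] and S_one = loc_S_one[OF M S] and S_carr = loc_S_carr[OF M S]
  note add = loc_add_frac[OF M S]
  have zero: "\<zero>\<^bsub>loc_module R S M\<^esub> = frac R S M \<zero>\<^bsub>M\<^esub> \<one>\<^bsub>R\<^esub>"
    by (simp add: loc_module_def)
  show ?thesis
  proof (rule abelian_monoidI; (unfold carrier_loc_module)?)
    fix X Y assume "\<exists>m\<in>carrier M. \<exists>s\<in>S. X = frac R S M m s" "\<exists>m\<in>carrier M. \<exists>s\<in>S. Y = frac R S M m s"
    then obtain m s n t where X: "m \<in> carrier M" "s \<in> S" "X = frac R S M m s"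
      and Y: "n \<in> carrier M" "t \<in> S" "Y = frac R S M n t" by blast
    show "\<exists>m\<in>carrier M. \<exists>s\<in>S. X \<oplus>\<^bsub>loc_module R S M\<^esub> Y = frac R S M m s"
      using X Y by (force simp: add S_mult S_carr)
    show "X \<oplus>\<^bsub>loc_module R S M\<^esub> Y = Y \<oplus>\<^bsub>loc_module R S M\<^esub> X"
      using X Y by (simp add: add S_carr M.a_comm R.m_comm)
    fix Z assume "\<exists>m\<in>carrier M. \<exists>s\<in>S. Z = frac R S M m s"
    then obtain p v where Z: "p \<in> carrier M" "v \<in> S" "Z = frac R S M p v" by blast
    show "X \<oplus>\<^bsub>loc_module R S M\<^esub> Y \<oplus>\<^bsub>loc_module R S M\<^esub> Z =
      X \<oplus>\<^bsub>loc_module R S M\<^esub> (Y \<oplus>\<^bsub>loc_module R S M\<^esub> Z)"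
      using X Y Z
      by (simp add: add S_mult S_carr smult_r_distr smult_assoc1[symmetric] M.a_assoc R.m_assoc
          R.m_comm[of v])
  next
    show "\<exists>m\<in>carrier M. \<exists>s\<in>S. \<zero>\<^bsub>loc_module R S M\<^esub> = frac R S M m s"
      using S_one by (auto simp: zero)
    fix X assume "\<exists>m\<in>carrier M. \<exists>s\<in>S. X = frac R S M m s"
    then show "\<zero>\<^bsub>loc_module R S M\<^esub> \<oplus>\<^bsub>loc_module R S M\<^esub> X = X"
      by (auto simp: zero add S_one S_carr)
  qed
qed

context cring
begin

lemma ideal_module_module:
  assumes "ideal J R"
  shows "module R (ideal_module R J)"
proof -
  interpret J: ideal J R by fact
  note [simp] = J.Icarr
  have *: "\<exists>y\<in>J. x \<oplus> y = \<zero>" if "x \<in> J" for x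
    using that by (intro bexI[of _ "\<ominus> x"]) (auto simp: r_neg)
  show ?thesis
    by (rule moduleI)
       (auto simp: ideal_module_def is_cring a_ac l_distr r_distr m_assoc J.I_l_closed *
         intro!: abelian_groupI)
qed

lemma primeideal_submonoid:
  assumes "primeideal P R"
  shows "submonoid (carrier R - P) R"
proof -
  interpret P: primeideal P R by fact
  show ?thesis
    by (rule submonoid.intro) (use P.I_prime P.I_notcarr P.one_imp_carrier in auto)
qed

text \<open>The basis element of the localization is a fraction with numerator \<open>j\<close>.
  Existence of coordinates, after clearing denominators, says that \<open>j\<close> generates
  \<open>J\<close> locally; uniqueness of the coordinates of zero says that \<open>j\<close> is
  locally a non-zerodivisor.\<close>

lemma has_rank_1_local_generator:
  assumes J: "ideal J R" and rank: "has_rank R (ideal_module R J) 1" and P: "primeideal P R"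
  obtains j where "j \<in> J"
    and "\<And>y. y \<in> J \<Longrightarrow> \<exists>s \<in> carrier R - P. \<exists>a \<in> carrier R. s \<otimes> y = a \<otimes> j"
    and "\<And>a. a \<in> carrier R \<Longrightarrow> a \<otimes> j = \<zero> \<Longrightarrow> \<exists>s \<in> carrier R - P. s \<otimes> a = \<zero>"
proof -
  define S where "S = carrier R - P"
  define M where "M = ideal_module R J"
  define A where "A = ideal_module R (carrier R)"
  have S: "submonoid S R" unfolding S_def by (rule primeideal_submonoid[OF P])
  have M: "module R M" unfolding M_def by (rule ideal_module_module[OF J])
  have A: "module R A" unfolding A_def by (rule ideal_module_module[OF oneideal])
  interpret L: abelian_monoid "loc_module R S M" by (rule loc_module_abelian_monoid[OF M S])
  note S_mult = loc_S_mult[OF M S] and S_one = loc_S_one[OF M S] and S_carr = loc_S_carr[OF M S]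
  note Jc = ideal.Icarr[OF J]
  have [simp]: "carrier M = J" "carrier A = carrier R" "smult M = monoid.mult R" "zero M = \<zero>"
    "smult A = monoid.mult R" "zero A = \<zero>"
    by (simp_all add: M_def A_def ideal_module_def)
  have ring_carr: "carrier (loc_ring R S) = carrier (loc_module R S A)"
    by (simp add: loc_ring_def Let_def A_def)
  define coords where "coords e x r \<longleftrightarrow> r \<in> {..<1::nat} \<rightarrow>\<^sub>E carrier (loc_ring R S) \<and>
    x = (\<Oplus>\<^bsub>loc_module R S M\<^esub> i \<in> {..<1}. r i \<odot>\<^bsub>loc_module R S M\<^esub> e i)" for e x r
  obtain e where e: "e \<in> {..<1} \<rightarrow> carrier (loc_module R S M)"
    and ex1: "\<forall>x \<in> carrier (loc_module R S M). \<exists>!r. coords e x r"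
  proof -
    have "free_of_rank (loc_ring R S) (loc_module R S M) 1"
      using rank P unfolding has_rank_def M_def S_def by blast
    then show thesis unfolding free_of_rank_def coords_def[symmetric] by (rule bexE) (rule that)
  qed
  have "e 0 \<in> carrier (loc_module R S M)" using e by auto
  then obtain j s where j: "j \<in> J" and s: "s \<in> S" and e0: "e 0 = frac R S M j s"
    unfolding carrier_loc_module by auto
  note smult = loc_smult_frac[OF M S, folded A_def]
  have smult_e: "frac R S A a t \<odot>\<^bsub>loc_module R S M\<^esub> e 0 = frac R S M (a \<otimes> j) (t \<otimes> s)"
    if "a \<in> carrier R" "t \<in> S" for a t
    using smult[OF that] j s by (simp add: e0)
  have single: "(\<Oplus>\<^bsub>loc_module R S M\<^esub> i \<in> {..<1::nat}. r i \<odot>\<^bsub>loc_module R S M\<^esub> e i) =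
      frac R S M (a \<otimes> j) (t \<otimes> s)"
    if "r 0 = frac R S A a t" "a \<in> carrier R" "t \<in> S" for r a t
  proof -
    have "frac R S M (a \<otimes> j) (t \<otimes> s) \<in> carrier (loc_module R S M)"
      unfolding carrier_loc_module
      using ideal.I_l_closed[OF J j that(2)] S_mult[OF that(3) s]
      by (intro bexI[of _ "a \<otimes> j"] bexI[of _ "t \<otimes> s"] refl) simp_all
    then show ?thesis
      using L.finsum_insert[of "{}" 0 "\<lambda>i. r i \<odot>\<^bsub>loc_module R S M\<^esub> e i"] that
      by (simp add: smult_e lessThan_Suc)
  qed
  show thesis
  proof (rule that[OF j, folded S_def])
    fix y assume y: "y \<in> J"
    have "frac R S M y \<one> \<in> carrier (loc_module R S M)"
      unfolding carrier_loc_module using y S_one by (intro bexI[of _ y] bexI[of _ \<one>] refl) simp_all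
    then obtain r where "coords e (frac R S M y \<one>) r"
      using ex1 by blast
    then have r: "r \<in> {..<1::nat} \<rightarrow>\<^sub>E carrier (loc_ring R S)"
      and eq: "frac R S M y \<one> = (\<Oplus>\<^bsub>loc_module R S M\<^esub> i \<in> {..<1}. r i \<odot>\<^bsub>loc_module R S M\<^esub> e i)"
      by (simp_all only: coords_def)
    have "r 0 \<in> carrier (loc_module R S A)" using r unfolding ring_carr by auto
    then obtain a t where at: "a \<in> carrier R" "t \<in> S" "r 0 = frac R S A a t"
      unfolding carrier_loc_module by auto
    have "frac R S M y \<one> = frac R S M (a \<otimes> j) (t \<otimes> s)" using eq single at by simp
    then obtain u where u: "u \<in> S" "u \<otimes> (t \<otimes> s \<otimes> y) = u \<otimes> (\<one> \<otimes> (a \<otimes> j))"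
      using frac_eq_iff[OF M S, of y "a \<otimes> j" \<one> "t \<otimes> s"] y at j s S_one S_mult
        ideal.I_l_closed[OF J] by auto
    have "(u \<otimes> (t \<otimes> s)) \<otimes> y = (u \<otimes> a) \<otimes> j"
      using u at s y j by (simp add: S_carr Jc m_assoc)
    moreover have "u \<otimes> (t \<otimes> s) \<in> S" "u \<otimes> a \<in> carrier R" using u at s S_mult S_carr by auto
    ultimately show "\<exists>s\<in>S. \<exists>a\<in>carrier R. s \<otimes> y = a \<otimes> j" by blast
  next
    fix a assume a: "a \<in> carrier R" and aj: "a \<otimes> j = \<zero>"
    define f where "f b = (\<lambda>i\<in>{..<1::nat}. frac R S A b \<one>)" for b
    have f: "f b \<in> {..<1} \<rightarrow>\<^sub>E carrier (loc_ring R S)" if "b \<in> carrier R" for b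
    proof -
      have "frac R S A b \<one> \<in> carrier (loc_module R S A)"
        unfolding carrier_loc_module using that S_one
        by (intro bexI[of _ b] bexI[of _ \<one>] refl) simp_all
      then show ?thesis by (simp add: f_def ring_carr)
    qed
    \<comment> \<open>The zero fraction, with the denominator that \<open>single\<close> produces,
      so that \<open>f a\<close> and \<open>f \<zero>\<close> are visibly both coordinates of
      it.\<close>
    define x where "x = frac R S M \<zero> (\<one> \<otimes> s)"
    have x: "x \<in> carrier (loc_module R S M)"
      unfolding carrier_loc_module x_def
      using additive_subgroup.zero_closed[OF ideal.axioms(1)[OF J]] S_mult[OF S_one s]
      by (intro bexI[of _ \<zero>] bexI[of _ "\<one> \<otimes> s"] refl) simp_all
    have "x = (\<Oplus>\<^bsub>loc_module R S M\<^esub> i \<in> {..<1}. f a i \<odot>\<^bsub>loc_module R S M\<^esub> e i)"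
      "x = (\<Oplus>\<^bsub>loc_module R S M\<^esub> i \<in> {..<1}. f \<zero> i \<odot>\<^bsub>loc_module R S M\<^esub> e i)"
      using single[of "f a" a \<one>] single[of "f \<zero>" \<zero> \<one>] a aj j S_one
      by (simp_all add: f_def x_def Jc)
    then have "coords e x (f a)" "coords e x (f \<zero>)"
      using f[OF a] f[OF zero_closed] by (simp_all only: coords_def)
    then have "f a = f \<zero>" using ex1 x by blast
    then have "frac R S A a \<one> = frac R S A \<zero> \<one>" unfolding f_def by (auto dest: fun_cong[of _ _ 0])
    then obtain u where "u \<in> S" "u \<otimes> (\<one> \<otimes> a) = u \<otimes> (\<one> \<otimes> \<zero>)"
      using frac_eq_iff[OF A S, of a \<zero> \<one> \<one>] a S_one by auto
    then show "\<exists>s\<in>S. s \<otimes> a = \<zero>" using a S_carr by auto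
  qed
qed

text \<open>Membership is tested at each prime \<open>P\<close>. With a local generator
  \<open>j\<close>, the hypothesis for \<open>y = j^m\<close> makes \<open>s x - a j^n\<close>
  annihilated by \<open>j^m\<close>, hence by some \<open>t\<close> outside \<open>P\<close>; then
  \<open>t s x\<close> lies in \<open>J^n\<close>.\<close>

lemma rank_1_ideal_pow_colon:
  assumes J: "ideal J R" and rank: "has_rank R (ideal_module R J) 1"
    and x: "x \<in> carrier R" "\<And>y. y \<in> ideal_pow R J m \<Longrightarrow> x \<otimes> y \<in> ideal_pow R J (n + m)"
  shows "x \<in> ideal_pow R J n"
proof (rule mem_ideal_locally[OF ideal_ideal_pow[OF J] x(1)])
  fix P assume P: "primeideal P R"
  obtain j where j: "j \<in> J"
    and gen: "\<And>y. y \<in> J \<Longrightarrow> \<exists>s \<in> carrier R - P. \<exists>a \<in> carrier R. s \<otimes> y = a \<otimes> j"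
    and nzd: "\<And>a. a \<in> carrier R \<Longrightarrow> a \<otimes> j = \<zero> \<Longrightarrow> \<exists>s \<in> carrier R - P. s \<otimes> a = \<zero>"
    using has_rank_1_local_generator[OF J rank P] by metis
  have S_mult: "s \<otimes> t \<in> carrier R - P" if "s \<in> carrier R - P" "t \<in> carrier R - P" for s t
    using submonoid.m_closed[OF primeideal_submonoid[OF P] that] .
  have S_one: "\<one> \<in> carrier R - P"
    using submonoid.one_closed[OF primeideal_submonoid[OF P]] .
  have jc: "j \<in> carrier R" using ideal.Icarr[OF J j] .
  have jpow: "j [^] k \<in> ideal_pow R J k" for k :: nat
    using nat_pow_in_ideal_pow[OF J, of j "Suc 0" k] j by (simp only: ideal_pow_1[OF J]) simp
  have gen_pow: "\<exists>s \<in> carrier R - P. \<exists>a \<in> carrier R. s \<otimes> y = a \<otimes> j [^] k"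
    if "y \<in> ideal_pow R J k" for y k
    using that
  proof (induction k arbitrary: y)
    case 0
    then show ?case using S_one by (intro bexI[of _ \<one>] bexI[of _ y]) auto
  next
    case (Suc k)
    have "y \<in> ideal_pow R J k \<cdot> J" using Suc.prems by simp
    then show ?case
    proof (induction y)
      case (prod y i)
      obtain s a where s: "s \<in> carrier R - P" "a \<in> carrier R" "s \<otimes> y = a \<otimes> j [^] k"
        using Suc.IH[OF prod(1)] by blast
      obtain t b where t: "t \<in> carrier R - P" "b \<in> carrier R" "t \<otimes> i = b \<otimes> j"
        using gen[OF prod(2)] by blast
      have carr: "y \<in> carrier R" "i \<in> carrier R" "s \<in> carrier R" "t \<in> carrier R" "j [^] k \<in> carrier R"
        using ideal.Icarr[OF ideal_ideal_pow[OF J] prod(1)] ideal.Icarr[OF J prod(2)] s t jc by auto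
      have "(s \<otimes> t) \<otimes> (y \<otimes> i) = (s \<otimes> y) \<otimes> (t \<otimes> i)" using carr by algebra
      also have "\<dots> = (a \<otimes> b) \<otimes> (j [^] k \<otimes> j)"
        unfolding s(3) t(3) using carr s(2) t(2) jc by algebra
      finally show ?case using S_mult[OF s(1) t(1)] s(2) t(2) by auto
    next
      case (sum y y')
      obtain s a where s: "s \<in> carrier R - P" "a \<in> carrier R" "s \<otimes> y = a \<otimes> j [^] Suc k"
        using sum.IH(1) by blast
      obtain t b where t: "t \<in> carrier R - P" "b \<in> carrier R" "t \<otimes> y' = b \<otimes> j [^] Suc k"
        using sum.IH(2) by blast
      define J' where "J' = j [^] Suc k"
      have carr: "y \<in> carrier R" "y' \<in> carrier R" "s \<in> carrier R" "t \<in> carrier R" "J' \<in> carrier R"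
        using ideal.Icarr[OF ideal_prod_is_ideal[OF ideal_ideal_pow[OF J] J]] sum.hyps s t jc
        unfolding J'_def by auto
      have "(s \<otimes> t) \<otimes> (y \<oplus> y') = t \<otimes> (s \<otimes> y) \<oplus> s \<otimes> (t \<otimes> y')" using carr by algebra
      also have "\<dots> = (t \<otimes> a \<oplus> s \<otimes> b) \<otimes> J'"
        unfolding s(3) t(3) J'_def[symmetric] using carr s(2) t(2) by algebra
      finally show ?case using S_mult[OF s(1) t(1)] s(2) t(2) carr unfolding J'_def by blast
    qed
  qed
  \<comment> \<open>One factor \<open>j\<close> is cancelled at a time, each at the cost of another
    multiplier outside \<open>P\<close>.\<close>
  have nzd_pow: "\<exists>s \<in> carrier R - P. s \<otimes> a = \<zero>" if "a \<in> carrier R" "a \<otimes> j [^] k = \<zero>" for a and k :: nat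
    using that
  proof (induction k arbitrary: a)
    case 0
    then show ?case using S_one by auto
  next
    case (Suc k)
    have "(a \<otimes> j) \<otimes> j [^] k = \<zero>"
      using Suc.prems jc m_comm[of j "j [^] k"] by (simp add: m_assoc)
    then obtain s where s: "s \<in> carrier R - P" "s \<otimes> (a \<otimes> j) = \<zero>"
      using Suc.IH[of "a \<otimes> j"] Suc.prems jc by auto
    then obtain t where t: "t \<in> carrier R - P" "t \<otimes> (s \<otimes> a) = \<zero>"
      using nzd[of "s \<otimes> a"] Suc.prems jc by (auto simp: m_assoc)
    then show ?case
      using S_mult[OF t(1) s(1)] s(1) Suc.prems(1) by (intro bexI[of _ "t \<otimes> s"]) (auto simp: m_assoc)
  qed
  obtain s a where s: "s \<in> carrier R - P" "a \<in> carrier R"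
    and eq: "s \<otimes> (x \<otimes> j [^] m) = a \<otimes> j [^] (n + m)"
    using gen_pow[OF x(2)[OF jpow]] by blast
  define p q where "p = j [^] n" and "q = j [^] m"
  have carr: "p \<in> carrier R" "q \<in> carrier R" "s \<in> carrier R" "a \<in> carrier R"
    unfolding p_def q_def using jc s by auto
  have eq': "s \<otimes> (x \<otimes> q) = a \<otimes> (p \<otimes> q)"
    using eq jc by (simp add: p_def q_def nat_pow_mult)
  have "(s \<otimes> x \<ominus> a \<otimes> p) \<otimes> q = s \<otimes> (x \<otimes> q) \<ominus> a \<otimes> (p \<otimes> q)"
    using carr x(1) by algebra
  also have "\<dots> = \<zero>" unfolding eq' using carr x(1) by algebra
  finally obtain t where t: "t \<in> carrier R - P" "t \<otimes> (s \<otimes> x \<ominus> a \<otimes> p) = \<zero>"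
    using nzd_pow[of "s \<otimes> x \<ominus> a \<otimes> p" m] carr x(1) unfolding q_def by auto
  have "(t \<otimes> s) \<otimes> x = t \<otimes> (s \<otimes> x \<ominus> a \<otimes> p) \<oplus> (t \<otimes> a) \<otimes> p"
  proof -
    have "t \<in> carrier R" using t(1) by simp
    then show ?thesis using carr x(1) by algebra
  qed
  also have "\<dots> = (t \<otimes> a) \<otimes> p" using t carr by simp
  also have "\<dots> \<in> ideal_pow R J n"
    unfolding p_def by (rule ideal.I_l_closed[OF ideal_ideal_pow[OF J] jpow]) (use t carr in auto)
  finally show "\<exists>s\<in>carrier R - P. s \<otimes> x \<in> ideal_pow R J n" using S_mult[OF t(1) s(1)] by blast
qed

end


section \<open>Power stability\<close>

lemma ideal_pow_subring_subset:
  "ideal_pow (B\<lparr>carrier := A\<rparr>) (I \<inter> A) n \<subseteq> ideal_pow B I n \<inter> A"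
  if "cring B" "subring A B" "ideal I B"
proof (induction n)
  case 0
  then show ?case using subringE(1)[OF that(2)] by auto
next
  case (Suc n)
  have "x \<in> ideal_pow B I (Suc n) \<inter> A" if "x \<in> ideal_pow (B\<lparr>carrier := A\<rparr>) (I \<inter> A) (Suc n)" for x
  proof -
    have "x \<in> ideal_pow (B\<lparr>carrier := A\<rparr>) (I \<inter> A) n \<cdot>\<^bsub>B\<lparr>carrier := A\<rparr>\<^esub> (I \<inter> A)" using that by simp
    then show ?thesis
      by induction
         (use Suc subringE(6,7)[OF \<open>subring A B\<close>] in \<open>auto intro: ideal_prod.intros\<close>)
  qed
  then show ?case by blast
qed

theorem theorem3p21:
  fixes B :: "('a, 'r) ring_scheme" and A I :: "'a set"
  assumes "cring B" and "subring A B" and "ideal I B"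
    and "ultimately_power_stable A B I"
  shows "(fg_module (B\<lparr>carrier := A\<rparr>) (ideal_module (B\<lparr>carrier := A\<rparr>) (I \<inter> A)) \<and>
          projective_module (B\<lparr>carrier := A\<rparr>) (ideal_module (B\<lparr>carrier := A\<rparr>) (I \<inter> A)) \<and>
          has_rank (B\<lparr>carrier := A\<rparr>) (ideal_module (B\<lparr>carrier := A\<rparr>) (I \<inter> A)) 1
            \<longrightarrow> power_stable A B I)
       \<and> (noetherian_ring (B\<lparr>carrier := A\<rparr>) \<and> noetherian_ring B \<and>
          radical_ideal (B\<lparr>carrier := A\<rparr>) (I \<inter> A) \<and>
          (\<exists>xs. regular_sequence (B\<lparr>carrier := A\<rparr>) xs \<and>
                I \<inter> A = Idl\<^bsub>B\<lparr>carrier := A\<rparr>\<^esub> (set xs))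
            \<longrightarrow> power_stable A B I)"
proof -
  interpret B: cring B by fact
  define R where "R = B\<lparr>carrier := A\<rparr>"
  define J where "J = I \<inter> A"
  have [simp]: "carrier R = A" "monoid.mult R = monoid.mult B" by (simp_all add: R_def)
  have AB: "A \<subseteq> carrier B" using subringE(1)[OF assms(2)] .
  interpret R: cring R
    unfolding R_def using B.subring_iff[OF AB] B.subcringI'[OF assms(2)] B.subcring_iff[OF AB] by blast
  interpret I: ideal I B by fact
  have J: "ideal J R"
    by (rule R.cring_idealI)
       (use subringE[OF assms(2)] AB in \<open>auto simp: J_def R_def subset_iff intro: I.I_l_closed\<close>)
  have sub: "ideal_pow R J n \<subseteq> ideal_pow B I n \<inter> A" for n
    unfolding R_def J_def by (rule ideal_pow_subring_subset[OF assms(1-3)])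
  obtain N where N: "\<And>n. n \<ge> N \<Longrightarrow> ideal_pow B I n \<inter> A = ideal_pow R J n"
    using assms(4) unfolding ultimately_power_stable_def R_def J_def by blast
  \<comment> \<open>The other inclusion is \<open>sub\<close>.\<close>
  have stable: "power_stable A B I"
    if "\<And>n x. x \<in> ideal_pow B I n \<Longrightarrow> x \<in> A \<Longrightarrow> x \<in> ideal_pow R J n"
    unfolding power_stable_def using that sub unfolding R_def J_def by blast
  have "power_stable A B I" if "has_rank R (ideal_module R J) 1"
  proof (rule stable)
    fix n x assume x: "x \<in> ideal_pow B I n" "x \<in> A"
    show "x \<in> ideal_pow R J n"
    proof (rule R.rank_1_ideal_pow_colon[OF J that])
      \<comment> \<open>Taking \<open>m = N\<close> in the colon lemma puts the exponent
        \<open>n + N\<close> of the product in the stable range.\<close>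
      fix y assume y: "y \<in> ideal_pow R J N"
      have "x \<otimes>\<^bsub>B\<^esub> y \<in> ideal_pow B I (n + N)"
        using B.mult_in_ideal_pow_add[OF assms(3) x(1)] y sub by blast
      moreover have "x \<otimes>\<^bsub>B\<^esub> y \<in> A" using x(2) y sub subringE(6)[OF assms(2)] by blast
      ultimately show "x \<otimes>\<^bsub>R\<^esub> y \<in> ideal_pow R J (n + N)" using N[of "n + N"] by auto
    qed (use x in simp)
  qed
  moreover have "power_stable A B I"
    if rad: "radical_ideal R J" and reg: "regular_sequence R xs" "J = Idl\<^bsub>R\<^esub> (set xs)" for xs
  proof (rule stable)
    have xs: "set xs \<subseteq> carrier R" using reg(1) by (simp add: regular_sequence_def)
    have "R.nzd_mod (Idl\<^bsub>R\<^esub> (set (take i xs))) (xs ! i)" if "i < length xs" for i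
    proof (rule R.nonzerodivisor_Quot)
      show "ideal (Idl\<^bsub>R\<^esub> (set (take i xs))) R"
        using xs set_take_subset[of i xs] by (intro R.genideal_ideal) blast
      show "xs ! i \<in> carrier R" using xs nth_mem[OF that] by blast
      show "nonzerodivisor (R Quot Idl\<^bsub>R\<^esub> (set (take i xs))) (Idl\<^bsub>R\<^esub> (set (take i xs)) +>\<^bsub>R\<^esub> xs ! i)"
        using reg(1) that unfolding regular_sequence_def Let_def by blast
    qed
    then have red: "R.ideal_pow_reduced J"
      using R.regular_imp_cancel_reduced[OF xs] reg(2) by simp
    fix n x assume x: "x \<in> ideal_pow B I n" "x \<in> A"
    \<comment> \<open>The order of \<open>x\<close> along \<open>J\<close> is raised one step at a
      time, up to \<open>n\<close>.\<close>
    have "x \<in> ideal_pow R J k" if "k \<le> n" for k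
      using that
    proof (induction k)
      case 0
      then show ?case using x by simp
    next
      case (Suc k)
      have "x [^]\<^bsub>B\<^esub> Suc N \<in> ideal_pow B I (n * Suc N)"
        by (rule B.nat_pow_in_ideal_pow[OF assms(3) x(1)])
      moreover have "x [^]\<^bsub>B\<^esub> Suc N = x [^]\<^bsub>R\<^esub> Suc N" by (simp add: R_def nat_pow_def)
      moreover have "x [^]\<^bsub>R\<^esub> Suc N \<in> A" using R.nat_pow_closed[of x "Suc N"] x(2) by simp
      \<comment> \<open>\<open>Suc k \<le> n\<close> forces \<open>n\<close> to be positive, so the
        exponent \<open>n * Suc N\<close> is in the stable range.\<close>
      moreover have "N \<le> n * Suc N" using Suc.prems by (cases n) auto
      ultimately have "x [^]\<^bsub>R\<^esub> Suc N \<in> ideal_pow R J (n * Suc N)" using N by auto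
      \<comment> \<open>The power of \<open>x\<close> lies at least one degree deeper than
        \<open>k * Suc N\<close>; the extra factor \<open>J\<close> takes the place of
        \<open>L\<close> in \<open>ideal_pow_reduced\<close>.\<close>
      moreover have "Suc (k * Suc N) \<le> n * Suc N"
        using mult_le_mono1[OF Suc.prems, of "Suc N"] by simp
      ultimately have "x [^]\<^bsub>R\<^esub> Suc N \<in> ideal_pow R J (Suc (k * Suc N))"
        using R.ideal_pow_antimono[OF J] by blast
      then have "x [^]\<^bsub>R\<^esub> Suc N \<in> J \<cdot>\<^bsub>R\<^esub> ideal_pow R J (k * Suc N)"
        by (simp only: ideal_pow_Suc R.ideal_prod_commute[OF R.ideal_ideal_pow[OF J] J])
      then have "x \<in> J \<cdot>\<^bsub>R\<^esub> ideal_pow R J k"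
        using red rad Suc unfolding R.ideal_pow_reduced_def by auto
      then show ?case by (simp only: ideal_pow_Suc R.ideal_prod_commute[OF R.ideal_ideal_pow[OF J] J])
    qed
    then show "x \<in> ideal_pow R J n" by blast
  qed
  ultimately show ?thesis unfolding R_def J_def by blast
qed

end
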